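(* Let user $m$ have instantaneous SNR $\Gamma_m(\tilde x)=\rho_m|h_m(\tilde x)|^2$ under the random LoS/NLoS channel model described in the context, where $\tilde x\in[0,D_x]$ is the antenna position and $r_m^2(\tilde x)=(x_m-\tilde x)^2+C_m$. Define $$a_m\triangleq\sqrt2\,\frac{\sqrt\eta}{\mu_m},\qquad b_m\big(r_m(\tilde x),t\big)\triangleq\sqrt2\,\frac{r_m(\tilde x)\sqrt{t/\rho_m}}{\mu_m}.$$ Then for every threshold $t\ge0$, the complementary cumulative distribution function of $\Gamma_m(\tilde x)$ is $$\Pr\big(\Gamma_m(\tilde x)\ge t\big)=e^{-\beta r_m^2(\tilde x)}\,Q_1\big(a_m,b_m(r_m(\tilde x),t)\big)+\big(1-e^{-\beta r_m^2(\tilde x)}\big)\exp\Big(-\frac{t\,r_m^2(\tilde x)}{\rho_m\mu_m^2}\Big),$$ where $Q_1$ is the first-order Marcum-$Q$ function. Moreover, for any fixed $t>0$, $\Pr(\Gamma_m(\tilde x)\ge t)$ is a strictly decreasing function of the distance $r_m(\tilde x)$ (with all of $\beta,\eta,\mu_m,\rho_m$ fixed).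
   Context: Parameters: $D_x>0$, $d_v>0$, $\eta>0$, $0\le\beta\le1$, $\rho_m>0$, wavelengths $\lambda,\lambda_g>0$, and user position $(x_m,y_m,0)$ with $x_m\in[0,D_x]$, $y_m\in\mathbb R$. The antenna is at $(\tilde x,0,d_v)$, $\tilde x\in[0,D_x]$. Set $C_m\triangleq y_m^2+d_v^2>0$ and $r_m(\tilde x)\triangleq\sqrt{(x_m-\tilde x)^2+C_m}$ (user-to-antenna distance). Channel model: $h_m(\tilde x)=\gamma_m h_m^{\mathrm{LoS}}(\tilde x)+h_m^{\mathrm{NLoS}}(\tilde x)$, where - $\gamma_m\in\{0,1\}$ is a Bernoulli random variable with $\Pr(\gamma_m=1)=e^{-\beta r_m^2(\tilde x)}$; - $h_m^{\mathrm{LoS}}(\tilde x)=\dfrac{\sqrt\eta\,e^{-j\left(\frac{2\pi}{\lambda}r_m(\tilde x)+\frac{2\pi}{\lambda_g}\tilde x\right)}}{r_m(\tilde x)}$ is deterministic ($j$ is the imaginary unit); - $h_m^{\mathrm{NLoS}}(\tilde x)=\sum_{n=1}^{N_c}g_{m,n}(\tilde x)$ with independent $g_{m,n}(\tilde x)\sim\mathcal{CN}\big(0,\mu_{m,n}^2/r_m^2(\tilde x)\big)$, so that $h_m^{\mathrm{NLoS}}(\tilde x)\sim\mathcal{CN}\big(0,\mu_m^2/r_m^2(\tilde x)\big)$ with $\mu_m^2\triangleq\sum_{n=1}^{N_c}\mu_{m,n}^2$ and $\mu_m>0$; - $\gamma_m$ and $h_m^{\mathrm{NLoS}}(\tilde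 x)$ are independent. Here $\mathcal{CN}(0,v)$ is the circularly symmetric complex Gaussian distribution with mean zero and variance $v$ (real and imaginary parts independent, each $\mathcal N(0,v/2)$). The first-order Marcum-$Q$ function is $$Q_1(a,b)=\int_b^\infty x\exp\Big(-\frac{x^2+a^2}{2}\Big)I_0(ax)\,dx,\qquad a,b\ge0,$$ with $I_0$ the modified Bessel function of the first kind of order zero. *)

theory Defs
  imports "HOL-Probability.Probability"
begin

definition bessel_I0 :: "real \<Rightarrow> real" where
  "bessel_I0 z = (\<Sum>k. (z / 2) ^ (2 * k) / (fact k)\<^sup>2)"

definition marcum_Q1 :: "real \<Rightarrow> real \<Rightarrow> real" where
  "marcum_Q1 a b =
     (LINT x:{b..}|lborel. x * exp (- (x\<^sup>2 + a\<^sup>2) / 2) * bessel_I0 (a * x))"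

text \<open>The second argument of \<^const>\<open>normal_density\<close> is the standard deviation, and the density is
  degenerate at 0; variance 0 therefore means the point mass at 0. It must be allowed, since single
  scatterers may have zero power.\<close>

definition real_gaussian :: "real \<Rightarrow> real measure" where
  "real_gaussian v =
     (if v = 0 then return borel 0 else density lborel (\<lambda>x. ennreal (normal_density 0 (sqrt v) x)))"

definition complex_gaussian :: "real \<Rightarrow> complex measure" where
  "complex_gaussian v =
     distr (real_gaussian (v / 2) \<Otimes>\<^sub>M real_gaussian (v / 2)) borel (\<lambda>(x, y). Complex x y)"

text \<open>The random elements \<open>los_flag\<close> and \<open>scatter\<close> are families indexed by the antenna position;
  the link between the antenna at \<open>(\<xi>, 0, height)\<close> and the user at \<open>(user_x, user_y, 0)\<close> is described
  by their members at \<open>\<xi>\<close>. Nothing is required about their joint law at different positions.\<close>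

record 'a channel =
  pspace :: "'a measure"
  Dx :: real
  height :: real
  user_x :: real
  user_y :: real
  eta :: real
  beta :: real
  rho :: real
  lam :: real
  lam_g :: real
  Nc :: nat
  mu :: "nat \<Rightarrow> real"
  los_flag :: "real \<Rightarrow> 'a \<Rightarrow> bool"
  scatter :: "nat \<Rightarrow> real \<Rightarrow> 'a \<Rightarrow> complex"

definition user_dist :: "'a channel \<Rightarrow> real \<Rightarrow> real" where
  "user_dist S \<xi> = sqrt ((user_x S - \<xi>)\<^sup>2 + ((user_y S)\<^sup>2 + (height S)\<^sup>2))"

definition mu_total :: "'a channel \<Rightarrow> real" where
  "mu_total S = sqrt (\<Sum>n = 1..Nc S. (mu S n)\<^sup>2)"

definition los_prob :: "'a channel \<Rightarrow> real \<Rightarrow> real" where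
  "los_prob S \<xi> = exp (- beta S * (user_dist S \<xi>)\<^sup>2)"

definition h_los :: "'a channel \<Rightarrow> real \<Rightarrow> complex" where
  "h_los S \<xi> =
     of_real (sqrt (eta S)) *
     exp (- (\<i> * of_real (2 * pi / lam S * user_dist S \<xi> + 2 * pi / lam_g S * \<xi>))) /
     of_real (user_dist S \<xi>)"

definition h_nlos :: "'a channel \<Rightarrow> real \<Rightarrow> 'a \<Rightarrow> complex" where
  "h_nlos S \<xi> \<omega> = (\<Sum>n = 1..Nc S. scatter S n \<xi> \<omega>)"

definition h_chan :: "'a channel \<Rightarrow> real \<Rightarrow> 'a \<Rightarrow> complex" where
  "h_chan S \<xi> \<omega> = of_bool (los_flag S \<xi> \<omega>) * h_los S \<xi> + h_nlos S \<xi> \<omega>"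

definition snr :: "'a channel \<Rightarrow> real \<Rightarrow> 'a \<Rightarrow> real" where
  "snr S \<xi> \<omega> = rho S * (cmod (h_chan S \<xi> \<omega>))\<^sup>2"

definition snr_ccdf :: "'a channel \<Rightarrow> real \<Rightarrow> real \<Rightarrow> real" where
  "snr_ccdf S \<xi> t = \<P>(\<omega> in pspace S. snr S \<xi> \<omega> \<ge> t)"

text \<open>In the last assumption the flag is embedded into the complex numbers because
  \<open>indep_var\<close> needs a common codomain; the embedding is injective, so nothing is lost.\<close>

locale los_nlos_channel =
  fixes S :: "'a channel"
  assumes prob_space: "prob_space (pspace S)"
    and Dx_pos: "Dx S > 0"
    and height_pos: "height S > 0"
    and user_x_range: "user_x S \<in> {0..Dx S}"
    and eta_pos: "eta S > 0"
    and beta_range: "beta S \<in> {0..1}"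
    and rho_pos: "rho S > 0"
    and lam_pos: "lam S > 0"
    and lam_g_pos: "lam_g S > 0"
    and mu_total_pos: "mu_total S > 0"
    and los_flag_measurable:
      "\<And>\<xi>. \<xi> \<in> {0..Dx S} \<Longrightarrow> los_flag S \<xi> \<in> measurable (pspace S) (count_space UNIV)"
    and los_flag_law:
      "\<And>\<xi>. \<xi> \<in> {0..Dx S} \<Longrightarrow>
         distr (pspace S) (count_space UNIV) (los_flag S \<xi>) =
         measure_pmf (bernoulli_pmf (los_prob S \<xi>))"
    and scatter_measurable:
      "\<And>\<xi> n. \<xi> \<in> {0..Dx S} \<Longrightarrow> n \<in> {1..Nc S} \<Longrightarrow> scatter S n \<xi> \<in> borel_measurable (pspace S)"
    and scatter_law:
      "\<And>\<xi> n. \<xi> \<in> {0..Dx S} \<Longrightarrow> n \<in> {1..Nc S} \<Longrightarrow>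
         distr (pspace S) borel (scatter S n \<xi>) =
         complex_gaussian ((mu S n)\<^sup>2 / (user_dist S \<xi>)\<^sup>2)"
    and scatter_indep:
      "\<And>\<xi>. \<xi> \<in> {0..Dx S} \<Longrightarrow>
         prob_space.indep_vars (pspace S) (\<lambda>_. borel) (\<lambda>n. scatter S n \<xi>) {1..Nc S}"
    and los_nlos_indep:
      "\<And>\<xi>. \<xi> \<in> {0..Dx S} \<Longrightarrow>
         prob_space.indep_var (pspace S)
           borel (\<lambda>\<omega>. of_bool (los_flag S \<xi> \<omega>) :: complex) borel (h_nlos S \<xi>)"

definition a_arg :: "'a channel \<Rightarrow> real" where
  "a_arg S = sqrt 2 * (sqrt (eta S) / mu_total S)"

definition b_arg :: "'a channel \<Rightarrow> real \<Rightarrow> real \<Rightarrow> real" where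
  "b_arg S r t = sqrt 2 * (r * sqrt (t / rho S) / mu_total S)"

end

(*
  Given the flag, the signal is a constant plus a circular Gaussian, so its squared modulus has a
  noncentral chi-squared law with two degrees of freedom; its tail is Q_1. This is computed in polar
  coordinates: expanding exp (r L) + exp (- r L), where L is the component of the mean along the
  direction of the point, the angular integrals of L ^ (2 * k) turn the series into that of I_0.
  The angular integrals themselves are read off from the even moments of a one-dimensional Gaussian.

  For monotonicity, Q_1 (a, b) is a Poisson mixture of Gamma tails, each of which is at least
  exp (- b\<^sup>2 / 2). So the LoS tail dominates the NLoS tail, both decrease strictly in b, and the weight
  of the LoS tail does not increase with the distance.
*)
theory Submission
  imports Defs
begin

section \<open>Polar coordinates and Gaussian measures\<close>

text \<open>Densities, series and tails are handled as nonnegative integrals, so Tonelli and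
  termwise integration apply without integrability conditions; integrability of the Marcum integrand
  is obtained afterwards, from total mass 1. With u = tan \<theta> as parameter, du / (1 + u^2) is
  d\<theta>, but u covers only a half circle. The other half consists of the antipodes, so each
  integrand occurs as a sum over a point and its antipode. This is the source of the pair exp (r L)
  + exp (- r L), whose odd powers cancel and leave a series with nonnegative terms. The angular
  integral of L^(2k) is never attacked directly: a Gaussian moment in the plane is evaluated once as
  a one-dimensional moment and once in polar coordinates, and the two values are compared. Variance
  0 has to be carried along throughout, because scatterers may have zero power and linear forms zero
  coefficients. The NLoS branch is the instance with mean 0 of the LoS computation, so a single tail
  formula serves both.\<close>

lemma nn_integral_lborel_fold:
  fixes f :: "real \<Rightarrow> ennreal"
  assumes [measurable]: "f \<in> borel_measurable borel"
  shows "(\<integral>\<^sup>+x. f x \<partial>lborel) = (\<integral>\<^sup>+x. (f x + f (- x)) * indicator {0..} x \<partial>lborel)"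
proof -
  have "(\<integral>\<^sup>+x. f x \<partial>lborel)
      = (\<integral>\<^sup>+x. f x * indicator {0..} x + f x * indicator {..0} x \<partial>lborel)"
    by (intro nn_integral_cong_AE eventually_mono[OF AE_lborel_singleton[of 0]])
       (auto simp: indicator_def)
  also have "\<dots> = (\<integral>\<^sup>+x. f x * indicator {0..} x \<partial>lborel) + (\<integral>\<^sup>+x. f x * indicator {..0} x \<partial>lborel)"
    by (intro nn_integral_add) auto
  also have "(\<integral>\<^sup>+x. f x * indicator {..0} x \<partial>lborel) = (\<integral>\<^sup>+x. f (- x) * indicator {0..} x \<partial>lborel)"
    by (subst nn_integral_real_affine[of _ "-1" 0])
       (auto simp: indicator_def intro!: nn_integral_cong)
  also have "(\<integral>\<^sup>+x. f x * indicator {0..} x \<partial>lborel) + \<dots>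
      = (\<integral>\<^sup>+x. f x * indicator {0..} x + f (- x) * indicator {0..} x \<partial>lborel)"
    by (intro nn_integral_add[symmetric]) auto
  finally show ?thesis
    by (simp add: distrib_right)
qed

text \<open>Polar coordinates with the tangent \<open>u\<close> of the angle as parameter: for fixed \<open>x\<close> the
  substitution \<open>y = x u\<close> and then for fixed \<open>u\<close> the substitution \<open>x = r / sqrt (1 + u\<^sup>2)\<close> are linear, so
  that Tonelli's theorem suffices.\<close>

lemma nn_integral_polar:
  fixes f :: "real \<Rightarrow> real \<Rightarrow> ennreal"
  assumes [measurable]: "(\<lambda>(x, y). f x y) \<in> borel_measurable (borel \<Otimes>\<^sub>M borel)"
  shows "(\<integral>\<^sup>+x. \<integral>\<^sup>+y. f x y \<partial>lborel \<partial>lborel)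
    = (\<integral>\<^sup>+u. \<integral>\<^sup>+r. ennreal (r / (1 + u\<^sup>2)) *
          (f (r / sqrt (1 + u\<^sup>2)) (r * u / sqrt (1 + u\<^sup>2)) +
           f (- r / sqrt (1 + u\<^sup>2)) (- r * u / sqrt (1 + u\<^sup>2))) * indicator {0..} r \<partial>lborel \<partial>lborel)"
proof -
  have [measurable]: "f x \<in> borel_measurable borel" for x
    using measurable_Pair2[OF assms] by simp
  have "(\<integral>\<^sup>+x. \<integral>\<^sup>+y. f x y \<partial>lborel \<partial>lborel)
      = (\<integral>\<^sup>+x. \<integral>\<^sup>+u. ennreal \<bar>x\<bar> * f x (x * u) \<partial>lborel \<partial>lborel)"
  proof (rule nn_integral_cong_AE[OF eventually_mono[OF AE_lborel_singleton[of 0]]])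
    fix x :: real assume "x \<noteq> 0"
    then show "(\<integral>\<^sup>+y. f x y \<partial>lborel) = (\<integral>\<^sup>+u. ennreal \<bar>x\<bar> * f x (x * u) \<partial>lborel)"
      by (subst nn_integral_real_affine[of _ x 0]) (auto intro!: nn_integral_cmult[symmetric])
  qed
  also have "\<dots> = (\<integral>\<^sup>+u. \<integral>\<^sup>+x. ennreal \<bar>x\<bar> * f x (x * u) \<partial>lborel \<partial>lborel)"
    by (rule lborel_pair.Fubini'[symmetric]) measurable
  also have "\<dots> = (\<integral>\<^sup>+u. \<integral>\<^sup>+r. ennreal (r / (1 + u\<^sup>2)) *
          (f (r / sqrt (1 + u\<^sup>2)) (r * u / sqrt (1 + u\<^sup>2)) +
           f (- r / sqrt (1 + u\<^sup>2)) (- r * u / sqrt (1 + u\<^sup>2))) * indicator {0..} r \<partial>lborel \<partial>lborel)"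
  proof (rule nn_integral_cong)
    fix u :: real
    define w where "w = sqrt (1 + u\<^sup>2)"
    have w: "w > 0" "w\<^sup>2 = 1 + u\<^sup>2"
      by (auto simp: w_def add_pos_nonneg)
    have "(\<integral>\<^sup>+x. ennreal \<bar>x\<bar> * f x (x * u) \<partial>lborel)
        = ennreal (1 / w) * (\<integral>\<^sup>+r. ennreal \<bar>r / w\<bar> * f (r / w) (r * u / w) \<partial>lborel)"
      using w by (subst nn_integral_real_affine[of _ "1 / w" 0]) auto
    \<comment> \<open>One factor \<open>1 / w\<close> is the Jacobian of \<open>x = r / w\<close>,
      the other comes from \<open>\<bar>x\<bar>\<close>; together they give
      \<open>1 / (1 + u\<^sup>2)\<close>.\<close>
    also have "\<dots> = (\<integral>\<^sup>+r. ennreal (\<bar>r\<bar> / (1 + u\<^sup>2)) * f (r / w) (r * u / w) \<partial>lborel)"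
      using w by (subst nn_integral_cmult[symmetric])
        (auto simp: mult.assoc[symmetric] ennreal_mult[symmetric] power2_eq_square simp flip: w(2))
    also have "\<dots> = (\<integral>\<^sup>+r. ennreal (r / (1 + u\<^sup>2)) * (f (r / w) (r * u / w) +
           f (- r / w) (- r * u / w)) * indicator {0..} r \<partial>lborel)"
      by (subst nn_integral_lborel_fold)
         (auto intro!: nn_integral_cong simp: indicator_def distrib_left)
    finally show "(\<integral>\<^sup>+x. ennreal \<bar>x\<bar> * f x (x * u) \<partial>lborel)
      = (\<integral>\<^sup>+r. ennreal (r / (1 + u\<^sup>2)) *
          (f (r / sqrt (1 + u\<^sup>2)) (r * u / sqrt (1 + u\<^sup>2)) +
           f (- r / sqrt (1 + u\<^sup>2)) (- r * u / sqrt (1 + u\<^sup>2))) * indicator {0..} r \<partial>lborel)"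
      unfolding w_def .
  qed
  finally show ?thesis .
qed

section \<open>Centred real Gaussian laws, degenerate ones included\<close>

lemma prob_space_std_normal: "prob_space (std_normal_distribution)"
  by (rule prob_space_normal_density) simp

text \<open>Serves to turn multiples of a standard normal into Gaussian laws and, conversely, to
  standardise. The case \<open>a = 0\<close> is included because a coefficient of a linear form may
  vanish.\<close>

lemma distr_scale_std_normal:
  "distr (std_normal_distribution) borel (\<lambda>x. a * x) = real_gaussian (a\<^sup>2)"
proof -
  interpret N: prob_space "std_normal_distribution"
    by (rule prob_space_std_normal)
  show ?thesis
  proof (cases "a = 0")
    case True
    then show ?thesis
      using N.distr_const[of 0 borel] by (simp add: real_gaussian_def)
  next
    case False
    have "distributed (std_normal_distribution) lborel (\<lambda>x. x) std_normal_density"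
      by (auto simp: distributed_def distr_id2)
    from N.normal_density_affine[OF this, of a 0] False
    have "distr (std_normal_distribution) lborel (\<lambda>x. a * x)
        = density lborel (normal_density 0 \<bar>a\<bar>)"
      by (simp add: distributed_def)
    then show ?thesis
      using False by (simp add: real_gaussian_def cong: distr_cong)
  qed
qed

lemma sets_real_gaussian [measurable_cong, simp]: "sets (real_gaussian v) = sets borel"
  by (simp add: real_gaussian_def)

lemma space_real_gaussian [simp]: "space (real_gaussian v) = UNIV"
  by (simp add: real_gaussian_def)

lemma prob_space_real_gaussian:
  assumes "v \<ge> 0"
  shows "prob_space (real_gaussian v)"
  using assms prob_space_normal_density[of "sqrt v" 0]
  by (auto simp: real_gaussian_def intro!: prob_space_return)

text \<open>For positive variances this is the convolution of two normal densities; a point mass has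
  no density, but it only shifts by 0. The form with an arbitrary integrand can be applied under
  further integrals, as the complex case requires.\<close>

lemma nn_integral_real_gaussian_add:
  fixes f :: "real \<Rightarrow> ennreal"
  assumes [measurable]: "f \<in> borel_measurable borel" and "v \<ge> 0" "w \<ge> 0"
  shows "(\<integral>\<^sup>+x. \<integral>\<^sup>+y. f (x + y) \<partial>real_gaussian w \<partial>real_gaussian v) = (\<integral>\<^sup>+x. f x \<partial>real_gaussian (v + w))"
proof -
  interpret v: prob_space "real_gaussian v"
    using assms by (intro prob_space_real_gaussian)
  interpret w: prob_space "real_gaussian w"
    using assms by (intro prob_space_real_gaussian)
  have [measurable]: "(\<lambda>x. \<integral>\<^sup>+y. f (x + y) \<partial>real_gaussian w) \<in> borel_measurable borel"
    by measurable
  have zero: "real_gaussian 0 = return borel 0"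
    by (simp add: real_gaussian_def)
  consider "v = 0" | "w = 0" | (both) "v > 0" "w > 0"
    using assms by fastforce
  then show ?thesis
  proof cases
    case 1
    then show ?thesis
      by (simp add: zero nn_integral_return)
  next
    case 2
    then show ?thesis
      by (simp add: zero nn_integral_return)
  next
    case both
    have "real_gaussian v \<star> real_gaussian w
        = density lborel (\<lambda>x. \<integral>\<^sup>+y. ennreal (normal_density 0 (sqrt v) (x - y)) * ennreal (normal_density 0 (sqrt w) y) \<partial>lborel)"
      using both by (simp add: real_gaussian_def convolution_density prob_space_normal_density 
          prob_space.finite_measure)
    also have "\<dots> = real_gaussian (v + w)"
      using both conv_normal_density_zero_mean[of "sqrt v" "sqrt w"]
      by (simp add: real_gaussian_def ennreal_mult)
    finally show ?thesis
      using nn_integral_convolution[of "real_gaussian v" "real_gaussian w" f] by simp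
  qed
qed

section \<open>Angular moments and radial tails\<close>

lemma nn_integral_std_normal:
  assumes [measurable]: "f \<in> borel_measurable borel"
  shows "(\<integral>\<^sup>+x. f x \<partial>std_normal_distribution) = (\<integral>\<^sup>+x. ennreal (std_normal_density x) * f x \<partial>lborel)"
  by (rule nn_integral_density) auto

text \<open>Rotation invariance enters here: a linear form in two independent standard normals has
  the law of \<open>sqrt (\<alpha>\<^sup>2 + \<beta>\<^sup>2)\<close> times one standard normal,
  whose moment of order 2k is (2k)! / (2^k k!).\<close>

lemma nn_integral_std_normal_linear_even_moment:
  "(\<integral>\<^sup>+x. \<integral>\<^sup>+y. ennreal ((\<alpha> * x + \<beta> * y) ^ (2 * k)) \<partial>std_normal_distribution \<partial>std_normal_distribution)
    = ennreal ((\<alpha>\<^sup>2 + \<beta>\<^sup>2) ^ k * (fact (2 * k) / (2 ^ k * fact k)))"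
proof -
  interpret N: prob_space std_normal_distribution
    by (rule prob_space_std_normal)
  interpret b: prob_space "real_gaussian (\<beta>\<^sup>2)"
    by (rule prob_space_real_gaussian) simp
  have [measurable]: "(\<lambda>x. \<integral>\<^sup>+y. ennreal ((x + y) ^ (2 * k)) \<partial>real_gaussian (\<beta>\<^sup>2)) \<in> borel_measurable borel"
    by measurable
  have "(\<integral>\<^sup>+x. \<integral>\<^sup>+y. ennreal ((\<alpha> * x + \<beta> * y) ^ (2 * k)) \<partial>std_normal_distribution \<partial>std_normal_distribution)
      = (\<integral>\<^sup>+x. \<integral>\<^sup>+y. ennreal ((\<alpha> * x + y) ^ (2 * k)) \<partial>real_gaussian (\<beta>\<^sup>2) \<partial>std_normal_distribution)"
    by (simp add: nn_integral_distr flip: distr_scale_std_normal)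
  also have "\<dots> = (\<integral>\<^sup>+x. \<integral>\<^sup>+y. ennreal ((x + y) ^ (2 * k)) \<partial>real_gaussian (\<beta>\<^sup>2) \<partial>real_gaussian (\<alpha>\<^sup>2))"
    by (subst distr_scale_std_normal[of \<alpha>, symmetric], subst nn_integral_distr) auto
  also have "\<dots> = (\<integral>\<^sup>+x. ennreal (x ^ (2 * k)) \<partial>real_gaussian (\<alpha>\<^sup>2 + \<beta>\<^sup>2))"
    by (rule nn_integral_real_gaussian_add) auto
  also have "real_gaussian (\<alpha>\<^sup>2 + \<beta>\<^sup>2) = distr std_normal_distribution borel (\<lambda>x. sqrt (\<alpha>\<^sup>2 + \<beta>\<^sup>2) * x)"
    by (simp add: distr_scale_std_normal)
  also have "nn_integral \<dots> (\<lambda>x. ennreal (x ^ (2 * k)))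
      = (\<integral>\<^sup>+x. ennreal ((\<alpha>\<^sup>2 + \<beta>\<^sup>2) ^ k) * ennreal (std_normal_density x * x ^ (2 * k)) \<partial>lborel)"
  proof -
    have "(sqrt (\<alpha>\<^sup>2 + \<beta>\<^sup>2) * x) ^ (2 * k) = (\<alpha>\<^sup>2 + \<beta>\<^sup>2) ^ k * x ^ (2 * k)" for x
      unfolding power_mult_distrib by (simp add: power_mult)
    then show ?thesis
      by (simp add: nn_integral_distr nn_integral_std_normal ennreal_mult[symmetric]
          zero_le_even_power mult.left_commute)
  qed
  also have "\<dots> = ennreal ((\<alpha>\<^sup>2 + \<beta>\<^sup>2) ^ k) * ennreal (fact (2 * k) / (2 ^ k * fact k))"
    using std_normal_moment_even[of k]
    by (subst nn_integral_cmult) (auto simp: nn_integral_eq_integral has_bochner_integral_iff)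
  finally show ?thesis
    by (subst ennreal_mult) auto
qed

text \<open>Integration by parts lowers the exponent by 2, which gives the recursion for the
  primitive \<open>G\<close>. The primitive is normalised to vanish at infinity, so that
  \<open>- F b\<close> is the tail from \<open>b\<close> on. The lower bound survives each step
  because the boundary term, an even power times an exponential, is nonnegative and may be
  dropped.\<close>

lemma gaussian_tail_primitive:
  "\<exists>F. (\<forall>x. (F has_real_derivative x ^ (2 * k + 1) * exp (- x\<^sup>2 / 2)) (at x))
     \<and> (F \<longlongrightarrow> 0) at_top \<and> F 0 = - (2 ^ k * fact k)
     \<and> (\<forall>x. 2 ^ k * fact k * exp (- x\<^sup>2 / 2) \<le> - F x)"
proof (induction k)
  case 0
  have "((\<lambda>x::real. - exp (- x\<^sup>2 / 2)) \<longlongrightarrow> 0) at_top"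
    by real_asymp
  then show ?case
    by (intro exI[of _ "\<lambda>x. - exp (- x\<^sup>2 / 2)"]) (auto intro!: derivative_eq_intros)
next
  case (Suc k)
  then obtain F where F: "\<And>x. (F has_real_derivative x ^ (2 * k + 1) * exp (- x\<^sup>2 / 2)) (at x)"
    "(F \<longlongrightarrow> 0) at_top" "F 0 = - (2 ^ k * fact k)" "\<And>x. 2 ^ k * fact k * exp (- x\<^sup>2 / 2) \<le> - F x"
    by auto
  define G where "G x = - (x ^ (2 * k + 2)) * exp (- x\<^sup>2 / 2) + 2 * real (Suc k) * F x" for x
  have lim0: "((\<lambda>x::real. - (x ^ (2 * k + 2)) * exp (- x\<^sup>2 / 2)) \<longlongrightarrow> 0) at_top"
    by real_asymp
  have "(G has_real_derivative x ^ (2 * Suc k + 1) * exp (- x\<^sup>2 / 2)) (at x)" for x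
  proof -
    have pow: "((\<lambda>x. x ^ (2 * k + 2)) has_real_derivative real (2 * k + 2) * x ^ (2 * k + 1)) (at x)"
      using DERIV_pow[of "2 * k + 2" x] by simp
    have exp: "((\<lambda>x. exp (- x\<^sup>2 / 2)) has_real_derivative - x * exp (- x\<^sup>2 / 2)) (at x)"
      by (auto intro!: derivative_eq_intros)
    show ?thesis
      unfolding G_def
      by (rule DERIV_cong, rule DERIV_add[OF DERIV_mult[OF DERIV_minus[OF pow] exp] DERIV_cmult[OF F(1)]])
         (simp add: algebra_simps)
  qed
  moreover have "(G \<longlongrightarrow> 0) at_top"
    unfolding G_def using tendsto_add[OF lim0 tendsto_mult_left[OF F(2), of "2 * real (Suc k)"]] by simp
  moreover have "G 0 = - (2 ^ Suc k * fact (Suc k))"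
    by (simp add: G_def F(3))
  moreover have "2 ^ Suc k * fact (Suc k) * exp (- x\<^sup>2 / 2) \<le> - G x" for x
  proof -
    have "2 ^ Suc k * fact (Suc k) * exp (- x\<^sup>2 / 2) = 2 * real (Suc k) * (2 ^ k * fact k * exp (- x\<^sup>2 / 2))"
      by simp
    also have "\<dots> \<le> 2 * real (Suc k) * (- F x)"
      by (intro mult_left_mono F) auto
    also have "\<dots> \<le> - G x"
      using mult_nonneg_nonneg[OF zero_le_even_power[of "2 * k + 2" x] exp_ge_zero[of "- x\<^sup>2 / 2"]]
      by (simp add: G_def)
    finally show ?thesis .
  qed
  ultimately show ?case
    by blast
qed

text \<open>For \<open>b \<ge> 0\<close> the substitution s = x^2 / 2 identifies this as 2^k times
  the upper incomplete Gamma function of k + 1 at b^2 / 2, that is, an unnormalised Gamma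
  tail.\<close>

definition gaussian_tail :: "nat \<Rightarrow> real \<Rightarrow> ennreal" where
  "gaussian_tail k b = (\<integral>\<^sup>+x. ennreal (x ^ (2 * k + 1) * exp (- x\<^sup>2 / 2)) * indicator {b..} x \<partial>lborel)"

text \<open>The value at 0 is the radial factor to be divided out when angular moments are computed;
  the lower bound later makes the LoS tail dominate the NLoS tail.\<close>

lemma
  shows gaussian_tail_0: "gaussian_tail k 0 = ennreal (2 ^ k * fact k)"
    and gaussian_tail_ge: "b \<ge> 0 \<Longrightarrow> ennreal (2 ^ k * fact k * exp (- b\<^sup>2 / 2)) \<le> gaussian_tail k b"
proof -
  obtain F where F: "\<And>x. (F has_real_derivative x ^ (2 * k + 1) * exp (- x\<^sup>2 / 2)) (at x)"
    "(F \<longlongrightarrow> 0) at_top" "F 0 = - (2 ^ k * fact k)" "\<And>x. 2 ^ k * fact k * exp (- x\<^sup>2 / 2) \<le> - F x"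
    using gaussian_tail_primitive[of k] by metis
  have eq: "gaussian_tail k b = ennreal (0 - F b)" if "b \<ge> 0" for b
    unfolding gaussian_tail_def using that by (intro nn_integral_FTC_atLeast F) auto
  show "gaussian_tail k 0 = ennreal (2 ^ k * fact k)"
    using F(3) by (simp add: eq)
  show "b \<ge> 0 \<Longrightarrow> ennreal (2 ^ k * fact k * exp (- b\<^sup>2 / 2)) \<le> gaussian_tail k b"
    using F(4)[of b] by (simp add: eq ennreal_leI)
qed

lemma nn_integral_first_moment_tail:
  assumes "b \<ge> 0"
  shows "(\<integral>\<^sup>+x. ennreal (x * exp (- x\<^sup>2 / 2)) * indicator {b..} x \<partial>lborel) = ennreal (exp (- b\<^sup>2 / 2))"
proof -
  have "((\<lambda>x::real. - exp (- x\<^sup>2 / 2)) \<longlongrightarrow> 0) at_top"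
    by real_asymp
  then show ?thesis
    using assms by (subst nn_integral_FTC_atLeast[of _ _ "\<lambda>x. - exp (- x\<^sup>2 / 2)" 0]) (auto intro!: derivative_eq_intros)
qed

section \<open>Angular integrals of even powers\<close>

lemma std_normal_density_mult:
  "std_normal_density x * std_normal_density y = exp (- (x\<^sup>2 + y\<^sup>2) / 2) / (2 * pi)"
proof -
  have "sqrt (2 * pi) * sqrt (2 * pi) = 2 * pi" by simp
  then show ?thesis
    by (simp add: std_normal_density_def mult_exp_exp add_divide_distrib[symmetric] divide_simps)
qed

text \<open>Shaped for polar integrands: the weight times the two antipodal values is to become a
  radial factor times an angular one, and the identity is checked over the reals.\<close>

lemma ennreal_mult_add_eq:
  assumes "w * (x + y) = c * d" "0 \<le> w" "0 \<le> x" "0 \<le> y" "0 \<le> c"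
  shows "ennreal w * (ennreal x + ennreal y) = ennreal c * ennreal d"
  using assms by (simp flip: ennreal_plus ennreal_mult' )

lemma polar_norm: "(r / sqrt (1 + u\<^sup>2))\<^sup>2 + (r * u / sqrt (1 + u\<^sup>2))\<^sup>2 = r\<^sup>2" for r u :: real
proof -
  have w: "1 + u\<^sup>2 > 0" by (simp add: add_pos_nonneg)
  then have "(r / sqrt (1 + u\<^sup>2))\<^sup>2 + (r * u / sqrt (1 + u\<^sup>2))\<^sup>2 = r\<^sup>2 * (1 + u\<^sup>2) / (1 + u\<^sup>2)"
    by (simp add: power_divide power_mult_distrib add_divide_distrib distrib_left)
  then show ?thesis using w by simp
qed

text \<open>With u = tan \<theta> the base is \<alpha> cos \<theta> + \<beta> sin \<theta>. In polar
  coordinates the planar Gaussian moment is this integral times an explicit radial constant, so the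
  known moment determines it.\<close>

lemma nn_integral_angular_moment:
  "(\<integral>\<^sup>+u. ennreal (((\<alpha> + \<beta> * u) / sqrt (1 + u\<^sup>2)) ^ (2 * k) / (1 + u\<^sup>2)) \<partial>lborel)
    = ennreal (pi * (\<alpha>\<^sup>2 + \<beta>\<^sup>2) ^ k * fact (2 * k) / (4 ^ k * (fact k)\<^sup>2))" (is "?A = _")
proof -
  interpret N: prob_space std_normal_distribution
    by (rule prob_space_std_normal)
  define L where "L u = (\<alpha> + \<beta> * u) / sqrt (1 + u\<^sup>2)" for u
  have [measurable]: "L \<in> borel_measurable borel"
    unfolding L_def by measurable
  have lin: "\<alpha> * (r / sqrt (1 + u\<^sup>2)) + \<beta> * (r * u / sqrt (1 + u\<^sup>2)) = r * L u" for r u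
    by (simp add: L_def add_divide_distrib distrib_left mult_ac)
  have w: "1 + u\<^sup>2 > 0" for u :: real by (simp add: add_pos_nonneg)
  have "ennreal ((\<alpha>\<^sup>2 + \<beta>\<^sup>2) ^ k * (fact (2 * k) / (2 ^ k * fact k)))
      = (\<integral>\<^sup>+x. \<integral>\<^sup>+y. ennreal (std_normal_density x * std_normal_density y * (\<alpha> * x + \<beta> * y) ^ (2 * k)) \<partial>lborel \<partial>lborel)"
    unfolding nn_integral_std_normal_linear_even_moment[symmetric]
    by (subst nn_integral_std_normal; (subst nn_integral_std_normal)?)
       (auto intro!: nn_integral_cong simp: ennreal_mult zero_le_even_power mult.assoc simp flip: nn_integral_cmult)
  \<comment> \<open>An even power agrees at antipodal points, so the summands double and
    \<open>1 / (2 * pi)\<close> becomes \<open>1 / pi\<close>; what remains is a function of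
    \<open>u\<close> times a function of \<open>r\<close>.\<close>
  also have "\<dots> = (\<integral>\<^sup>+u. \<integral>\<^sup>+r. ennreal (L u ^ (2 * k) / (1 + u\<^sup>2) / pi) *
         (ennreal (r ^ (2 * k + 1) * exp (- r\<^sup>2 / 2)) * indicator {0..} r) \<partial>lborel \<partial>lborel)"
    apply (subst nn_integral_polar)
     apply simp
    apply (intro nn_integral_cong)
    subgoal for u r
    proof (cases "r \<ge> 0")
      case True
      have nonneg: "0 \<le> r / (1 + u\<^sup>2)" "0 \<le> L u ^ (2 * k) / (1 + u\<^sup>2) / pi"
        using True w[of u] by (auto simp: zero_le_even_power)
      have dens_nonneg: "0 \<le> exp (- r\<^sup>2 / 2) / (2 * pi) * (z * L u) ^ (2 * k)" for z
        by (simp add: zero_le_even_power)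
      have "r / (1 + u\<^sup>2) * (exp (- r\<^sup>2 / 2) / (2 * pi) * (r * L u) ^ (2 * k)
              + exp (- r\<^sup>2 / 2) / (2 * pi) * (- r * L u) ^ (2 * k))
          = L u ^ (2 * k) / (1 + u\<^sup>2) / pi * (r ^ (2 * k + 1) * exp (- r\<^sup>2 / 2))"
        by (simp add: power_mult_distrib)
      from ennreal_mult_add_eq[OF this nonneg(1) dens_nonneg dens_nonneg nonneg(2)] show ?thesis
        unfolding std_normal_density_mult polar_norm lin power2_minus
        using True by simp
    qed simp
    done
  also have "\<dots> = ennreal (2 ^ k * fact k / pi) * ?A"
    unfolding L_def[symmetric]
    apply (subst nn_integral_cmult)
     apply simp
    apply (fold gaussian_tail_def)
    apply (simp add: gaussian_tail_0 flip: nn_integral_cmult)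
    apply (intro nn_integral_cong)
    apply (simp add: ennreal_mult[symmetric] zero_le_even_power mult_ac)
    done
  \<comment> \<open>Multiplying by the reciprocal of the finite constant isolates \<open>?A\<close>
    without first knowing that \<open>?A\<close> is finite.\<close>
  finally have "ennreal (pi / (2 ^ k * fact k)) * ennreal ((\<alpha>\<^sup>2 + \<beta>\<^sup>2) ^ k * (fact (2 * k) / (2 ^ k * fact k)))
      = ennreal (pi / (2 ^ k * fact k)) * (ennreal (2 ^ k * fact k / pi) * ?A)"
    by simp
  also have "\<dots> = ?A"
    by (simp add: ennreal_mult[symmetric] flip: mult.assoc)
  also have "ennreal (pi / (2 ^ k * fact k)) * ennreal ((\<alpha>\<^sup>2 + \<beta>\<^sup>2) ^ k * (fact (2 * k) / (2 ^ k * fact k)))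
      = ennreal (pi * (\<alpha>\<^sup>2 + \<beta>\<^sup>2) ^ k * fact (2 * k) / (4 ^ k * (fact k)\<^sup>2))"
    by (subst ennreal_mult[symmetric])
       (simp_all add: power2_eq_square mult_ac flip: power_mult_distrib)
  finally show ?thesis ..
qed

section \<open>The Rice distribution\<close>

lemma summable_bessel_I0: "summable (\<lambda>k. (z / 2) ^ (2 * k) / (fact k)\<^sup>2 :: real)"
proof (rule summable_comparison_test')
  show "summable (\<lambda>k. inverse (fact k) * ((z / 2)\<^sup>2) ^ k)"
    by (rule summable_exp)
  fix k
  have "(z / 2) ^ (2 * k) / (fact k)\<^sup>2 \<le> (z / 2) ^ (2 * k) / fact k"
    by (intro divide_left_mono zero_le_even_power) (auto simp: power2_eq_square)
  moreover have "0 \<le> (z / 2) ^ (2 * k)"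
    by (simp add: zero_le_even_power)
  ultimately show "norm ((z / 2) ^ (2 * k) / (fact k)\<^sup>2) \<le> inverse (fact k) * ((z / 2)\<^sup>2) ^ k"
    by (simp add: field_simps power_mult[symmetric] del: power_divide)
qed

lemma bessel_I0_ge_1: "bessel_I0 z \<ge> 1"
  using sum_le_suminf[OF summable_bessel_I0, of "{0}" z]
  by (simp add: bessel_I0_def zero_le_even_power)

lemma bessel_I0_nonneg: "bessel_I0 z \<ge> 0"
  using bessel_I0_ge_1[of z] by linarith

lemma ennreal_bessel_I0: "ennreal (bessel_I0 z) = (\<Sum>k. ennreal ((z / 2) ^ (2 * k) / (fact k)\<^sup>2))"
  unfolding bessel_I0_def
  by (intro suminf_ennreal2[symmetric] summable_bessel_I0) (simp add: zero_le_even_power)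

lemma measurable_bessel_I0 [measurable]: "bessel_I0 \<in> borel_measurable borel"
  unfolding bessel_I0_def by measurable

lemma ennreal_exp_add_exp_minus:
  "ennreal (exp z + exp (- z)) = (\<Sum>k. ennreal (2 * z ^ (2 * k) / fact (2 * k)))" for z :: real
proof -
  have "(\<lambda>n. if even n then inverse (fact n) * z ^ n else 0) sums cosh z"
    using cosh_converges[of z] by (simp add: divide_inverse mult.commute cong: if_cong)
  then have "(\<lambda>k. inverse (fact (2 * k)) * z ^ (2 * k)) sums cosh z"
    using sums_mono_reindex[of "\<lambda>k. 2 * k" "\<lambda>n. if even n then inverse (fact n) * z ^ n else 0" "cosh z"]
    by (force simp: strict_mono_def elim!: evenE)
  moreover have "exp z + exp (- z) = 2 * cosh z"
    by (simp add: cosh_def)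
  ultimately have "(\<lambda>k. 2 * z ^ (2 * k) / fact (2 * k)) sums (exp z + exp (- z))"
    using sums_mult[of "\<lambda>k. inverse (fact (2 * k)) * z ^ (2 * k)" "cosh z" 2]
    by (simp add: field_simps)
  then have "(\<Sum>k. 2 * z ^ (2 * k) / fact (2 * k)) = exp z + exp (- z)"
    "summable (\<lambda>k. 2 * z ^ (2 * k) / fact (2 * k))"
    by (auto simp: sums_iff)
  moreover have "0 \<le> 2 * z ^ (2 * k) / fact (2 * k)" for k
    by (simp add: zero_le_even_power)
  ultimately show ?thesis
    by (simp only: suminf_ennreal2)
qed

text \<open>The integral representation of I_0 over a half circle. Termwise, the (2k)! of the
  exponential series cancels the (2k)! of the angular moment and leaves 4^k (k!)^2, the denominators
  of I_0.\<close>

lemma nn_integral_angular_exp: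
  "(\<integral>\<^sup>+u. ennreal ((exp (r * ((\<alpha> + \<beta> * u) / sqrt (1 + u\<^sup>2))) + exp (- (r * ((\<alpha> + \<beta> * u) / sqrt (1 + u\<^sup>2))))) / (1 + u\<^sup>2)) \<partial>lborel)
    = ennreal (2 * pi * bessel_I0 (sqrt (\<alpha>\<^sup>2 + \<beta>\<^sup>2) * r))" (is "?A = _")
proof -
  define L where "L u = (\<alpha> + \<beta> * u) / sqrt (1 + u\<^sup>2)" for u
  have [measurable]: "L \<in> borel_measurable borel"
    unfolding L_def by measurable
  have "?A = (\<integral>\<^sup>+u. ennreal (exp (r * L u) + exp (- (r * L u))) * ennreal (1 / (1 + u\<^sup>2)) \<partial>lborel)"
    by (simp add: L_def ennreal_mult[symmetric] del: ennreal_plus)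
  also have "\<dots> = (\<integral>\<^sup>+u. (\<Sum>k. ennreal (2 * (r * L u) ^ (2 * k) / fact (2 * k)) * ennreal (1 / (1 + u\<^sup>2))) \<partial>lborel)"
    unfolding ennreal_exp_add_exp_minus by simp
  also have "\<dots> = (\<Sum>k. \<integral>\<^sup>+u. ennreal (2 * (r * L u) ^ (2 * k) / fact (2 * k)) * ennreal (1 / (1 + u\<^sup>2)) \<partial>lborel)"
    by (intro nn_integral_suminf) measurable
  also have "\<dots> = (\<Sum>k. ennreal (2 * pi) * ennreal ((sqrt (\<alpha>\<^sup>2 + \<beta>\<^sup>2) * r / 2) ^ (2 * k) / (fact k)\<^sup>2))"
  proof (rule suminf_cong)
    fix k
    have "(\<integral>\<^sup>+u. ennreal (2 * (r * L u) ^ (2 * k) / fact (2 * k)) * ennreal (1 / (1 + u\<^sup>2)) \<partial>lborel)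
        = (\<integral>\<^sup>+u. ennreal (2 * r ^ (2 * k) / fact (2 * k)) * ennreal (L u ^ (2 * k) / (1 + u\<^sup>2)) \<partial>lborel)"
      by (simp add: ennreal_mult[symmetric] zero_le_even_power power_mult_distrib mult.assoc)
    also have "\<dots> = ennreal (2 * r ^ (2 * k) / fact (2 * k)) *
        ennreal (pi * (\<alpha>\<^sup>2 + \<beta>\<^sup>2) ^ k * fact (2 * k) / (4 ^ k * (fact k)\<^sup>2))"
      unfolding nn_integral_angular_moment[symmetric] L_def by (rule nn_integral_cmult) measurable
    also have "\<dots> = ennreal (2 * pi) * ennreal ((sqrt (\<alpha>\<^sup>2 + \<beta>\<^sup>2) * r / 2) ^ (2 * k) / (fact k)\<^sup>2)"
    proof -
      have "(sqrt (\<alpha>\<^sup>2 + \<beta>\<^sup>2) * r / 2) ^ (2 * k) = (\<alpha>\<^sup>2 + \<beta>\<^sup>2) ^ k * r ^ (2 * k) / 4 ^ k"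
        unfolding power_mult_distrib power_divide by (simp add: power_mult)
      then show ?thesis
        by (simp add: ennreal_mult[symmetric] zero_le_even_power)
    qed
    finally show "(\<integral>\<^sup>+u. ennreal (2 * (r * L u) ^ (2 * k) / fact (2 * k)) * ennreal (1 / (1 + u\<^sup>2)) \<partial>lborel) = \<dots>" .
  qed
  also have "\<dots> = ennreal (2 * pi * bessel_I0 (sqrt (\<alpha>\<^sup>2 + \<beta>\<^sup>2) * r))"
    by (simp add: ennreal_bessel_I0 ennreal_mult bessel_I0_nonneg)
  finally show ?thesis .
qed

text \<open>The Marcum integral in \<open>ennreal\<close>, so that it can be manipulated before its
  integrand is known to be integrable.\<close>

definition rice_tail :: "real \<Rightarrow> real \<Rightarrow> ennreal" where
  "rice_tail a b = (\<integral>\<^sup>+x. ennreal (x * exp (- (x\<^sup>2 + a\<^sup>2) / 2) * bessel_I0 (a * x)) * indicator {b..} x \<partial>lborel)"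

text \<open>Translation moves the mean from the event into the density: the event becomes
  rotationally symmetric, and the density acquires the factor
  \<open>exp (\<alpha> * x + \<beta> * y)\<close>, the only part that depends on the angle.\<close>

lemma nn_integral_rice:
  assumes "b \<ge> 0"
  shows "(\<integral>\<^sup>+x. \<integral>\<^sup>+y. indicator {b\<^sup>2..} ((\<alpha> + x)\<^sup>2 + (\<beta> + y)\<^sup>2) \<partial>std_normal_distribution \<partial>std_normal_distribution)
    = rice_tail (sqrt (\<alpha>\<^sup>2 + \<beta>\<^sup>2)) b"
proof -
  interpret N: prob_space std_normal_distribution
    by (rule prob_space_std_normal)
  define L where "L u = (\<alpha> + \<beta> * u) / sqrt (1 + u\<^sup>2)" for u
  have [measurable]: "L \<in> borel_measurable borel"
    unfolding L_def by measurable
  have lin: "\<alpha> * (r / sqrt (1 + u\<^sup>2)) + \<beta> * (r * u / sqrt (1 + u\<^sup>2)) = r * L u" for r u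
    by (simp add: L_def add_divide_distrib distrib_left mult_ac)
  have w: "1 + u\<^sup>2 > 0" for u :: real by (simp add: add_pos_nonneg)
  define c where "c = \<alpha>\<^sup>2 + \<beta>\<^sup>2"
  have dens: "std_normal_density (x - \<alpha>) * std_normal_density (y - \<beta>)
      = exp (- (x\<^sup>2 + y\<^sup>2 + c) / 2) / (2 * pi) * exp (\<alpha> * x + \<beta> * y)" for x y
    unfolding std_normal_density_mult c_def
    by (simp add: mult_exp_exp power2_eq_square field_simps)
  have "(\<integral>\<^sup>+x. \<integral>\<^sup>+y. indicator {b\<^sup>2..} ((\<alpha> + x)\<^sup>2 + (\<beta> + y)\<^sup>2) \<partial>std_normal_distribution \<partial>std_normal_distribution)
      = (\<integral>\<^sup>+x. \<integral>\<^sup>+y. ennreal (std_normal_density x * std_normal_density y) * indicator {b\<^sup>2..} ((\<alpha> + x)\<^sup>2 + (\<beta> + y)\<^sup>2) \<partial>lborel \<partial>lborel)"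
    by (subst nn_integral_std_normal; (subst nn_integral_std_normal)?)
       (auto intro!: nn_integral_cong simp: ennreal_mult mult_ac simp flip: nn_integral_cmult)
  also have "\<dots> = (\<integral>\<^sup>+x. \<integral>\<^sup>+y. ennreal (std_normal_density (x - \<alpha>) * std_normal_density y) * indicator {b\<^sup>2..} (x\<^sup>2 + (\<beta> + y)\<^sup>2) \<partial>lborel \<partial>lborel)"
    by (subst nn_integral_real_affine[of _ 1 "- \<alpha>"]) auto
  also have "\<dots> = (\<integral>\<^sup>+x. \<integral>\<^sup>+y. ennreal (std_normal_density (x - \<alpha>) * std_normal_density (y - \<beta>)) * indicator {b\<^sup>2..} (x\<^sup>2 + y\<^sup>2) \<partial>lborel \<partial>lborel)"
  proof (rule nn_integral_cong)
    fix x
    show "(\<integral>\<^sup>+y. ennreal (std_normal_density (x - \<alpha>) * std_normal_density y) * indicator {b\<^sup>2..} (x\<^sup>2 + (\<beta> + y)\<^sup>2) \<partial>lborel)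
      = (\<integral>\<^sup>+y. ennreal (std_normal_density (x - \<alpha>) * std_normal_density (y - \<beta>)) * indicator {b\<^sup>2..} (x\<^sup>2 + y\<^sup>2) \<partial>lborel)"
      by (subst nn_integral_real_affine[of _ 1 "- \<beta>"]) auto
  qed
  \<comment> \<open>At a point and its antipode the angular factor is \<open>exp (r * L u)\<close>
    and \<open>exp (- (r * L u))\<close>; everything else is radial.\<close>
  also have "\<dots> = (\<integral>\<^sup>+u. \<integral>\<^sup>+r. ennreal (r * exp (- (r\<^sup>2 + c) / 2) / (2 * pi)) * indicator {b..} r *
      ennreal ((exp (r * L u) + exp (- (r * L u))) / (1 + u\<^sup>2)) \<partial>lborel \<partial>lborel)"
    unfolding dens
    apply (subst nn_integral_polar)
     apply simp
    apply (intro nn_integral_cong)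
    subgoal for u r
    proof (cases "r \<ge> 0")
      case True
      have "b\<^sup>2 \<le> r\<^sup>2 \<longleftrightarrow> b \<le> r"
        using True assms by (auto simp: power2_le_iff_abs_le)
      moreover have "ennreal (r / (1 + u\<^sup>2)) * (ennreal (exp (- (r\<^sup>2 + c) / 2) / (2 * pi) * exp (r * L u))
            + ennreal (exp (- (r\<^sup>2 + c) / 2) / (2 * pi) * exp (- r * L u)))
          = ennreal (r * exp (- (r\<^sup>2 + c) / 2) / (2 * pi)) * ennreal ((exp (r * L u) + exp (- (r * L u))) / (1 + u\<^sup>2))"
        using True w[of u] by (intro ennreal_mult_add_eq) (simp_all add: distrib_left add_divide_distrib mult_ac)
      ultimately show ?thesis
        unfolding polar_norm lin power2_minus
        using True by (cases "b \<le> r") simp_all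
    \<comment> \<open>For \<open>r < 0\<close> both sides vanish, the right one because
      \<open>b \<ge> 0\<close> keeps \<open>r\<close> out of \<open>{b..}\<close>.\<close>
    qed (use assms in \<open>simp add: indicator_def\<close>)
    done
  also have "\<dots> = (\<integral>\<^sup>+r. \<integral>\<^sup>+u. ennreal (r * exp (- (r\<^sup>2 + c) / 2) / (2 * pi)) * indicator {b..} r *
      ennreal ((exp (r * L u) + exp (- (r * L u))) / (1 + u\<^sup>2)) \<partial>lborel \<partial>lborel)"
    by (rule lborel_pair.Fubini') measurable
  also have "\<dots> = rice_tail (sqrt (\<alpha>\<^sup>2 + \<beta>\<^sup>2)) b"
    unfolding rice_tail_def
  proof (rule nn_integral_cong)
    fix r
    have "(\<integral>\<^sup>+u. ennreal (r * exp (- (r\<^sup>2 + c) / 2) / (2 * pi)) * indicator {b..} r *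
        ennreal ((exp (r * L u) + exp (- (r * L u))) / (1 + u\<^sup>2)) \<partial>lborel)
      = ennreal (r * exp (- (r\<^sup>2 + c) / 2) / (2 * pi)) * indicator {b..} r * ennreal (2 * pi * bessel_I0 (sqrt c * r))"
      by (subst nn_integral_cmult) (simp, simp only: L_def nn_integral_angular_exp c_def)
    also have "\<dots> = ennreal (r * exp (- (r\<^sup>2 + (sqrt (\<alpha>\<^sup>2 + \<beta>\<^sup>2))\<^sup>2) / 2) * bessel_I0 (sqrt (\<alpha>\<^sup>2 + \<beta>\<^sup>2) * r)) * indicator {b..} r"
      using assms by (auto simp: indicator_def ennreal_mult[symmetric] bessel_I0_nonneg c_def)
    finally show "(\<integral>\<^sup>+u. ennreal (r * exp (- (r\<^sup>2 + c) / 2) / (2 * pi)) * indicator {b..} r *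
        ennreal ((exp (r * L u) + exp (- (r * L u))) / (1 + u\<^sup>2)) \<partial>lborel) = \<dots>" .
  qed
  finally show ?thesis .
qed

text \<open>By \<open>nn_integral_rice\<close> with mean (a, 0) the tail is a probability. This is
  what yields integrability of the Marcum integrand.\<close>

lemma rice_tail_le_1:
  assumes "a \<ge> 0" "b \<ge> 0"
  shows "rice_tail a b \<le> 1"
proof -
  interpret N: prob_space std_normal_distribution
    by (rule prob_space_std_normal)
  have "(\<integral>\<^sup>+x. \<integral>\<^sup>+y. indicator {b\<^sup>2..} ((a + x)\<^sup>2 + (0 + y)\<^sup>2) \<partial>std_normal_distribution \<partial>std_normal_distribution)
      \<le> (\<integral>\<^sup>+x. \<integral>\<^sup>+y. 1 \<partial>std_normal_distribution \<partial>std_normal_distribution)"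
    by (intro nn_integral_mono) (auto simp: indicator_def)
  then show ?thesis
    using nn_integral_rice[of b a 0] assms N.emeasure_space_1 by simp
qed

lemma marcum_Q1_eq_rice_tail:
  assumes "a \<ge> 0" "b \<ge> 0"
  shows "ennreal (marcum_Q1 a b) = rice_tail a b"
proof -
  let ?f = "\<lambda>x. indicator {b..} x *\<^sub>R (x * exp (- (x\<^sup>2 + a\<^sup>2) / 2) * bessel_I0 (a * x))"
  have eq: "rice_tail a b = (\<integral>\<^sup>+x. ennreal (?f x) \<partial>lborel)"
    unfolding rice_tail_def by (intro nn_integral_cong) (simp split: split_indicator)
  have nonneg: "?f x \<ge> 0" for x
    using assms by (simp add: bessel_I0_nonneg split: split_indicator)
  have "integrable lborel ?f"
  proof (rule integrableI_nonneg)
    show "(\<integral>\<^sup>+x. ennreal (?f x) \<partial>lborel) < \<infinity>"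
      using rice_tail_le_1[OF assms] unfolding eq by (rule le_less_trans) simp
  qed (use nonneg in auto)
  then show ?thesis
    unfolding eq marcum_Q1_def set_lebesgue_integral_def
    using nonneg by (subst nn_integral_eq_integral) auto
qed

section \<open>Monotonicity of the Marcum function\<close>

lemma bessel_I0_0: "bessel_I0 0 = 1"
  unfolding bessel_I0_def by (subst suminf_finite[of "{0}"]) auto

lemma rice_tail_0:
  assumes "b \<ge> 0"
  shows "rice_tail 0 b = ennreal (exp (- b\<^sup>2 / 2))"
  using nn_integral_first_moment_tail[OF assms] by (simp add: rice_tail_def bessel_I0_0)

text \<open>The Poisson mixture in unnormalised form: multiplied by \<open>2 ^ k * fact k\<close>,
  the value of \<open>gaussian_tail k 0\<close>, the coefficient becomes the Poisson weight with
  parameter a^2 / 2.\<close>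

lemma rice_tail_series:
  assumes "b \<ge> 0"
  shows "rice_tail a b = (\<Sum>k. ennreal (exp (- a\<^sup>2 / 2) * ((a / 2) ^ (2 * k) / (fact k)\<^sup>2)) * gaussian_tail k b)"
proof -
  have "rice_tail a b = (\<integral>\<^sup>+x. (\<Sum>k. ennreal (exp (- a\<^sup>2 / 2) * ((a / 2) ^ (2 * k) / (fact k)\<^sup>2)) *
      (ennreal (x ^ (2 * k + 1) * exp (- x\<^sup>2 / 2)) * indicator {b..} x)) \<partial>lborel)"
    unfolding rice_tail_def
  proof (rule nn_integral_cong)
    fix x
    show "ennreal (x * exp (- (x\<^sup>2 + a\<^sup>2) / 2) * bessel_I0 (a * x)) * indicator {b..} x
      = (\<Sum>k. ennreal (exp (- a\<^sup>2 / 2) * ((a / 2) ^ (2 * k) / (fact k)\<^sup>2)) *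
          (ennreal (x ^ (2 * k + 1) * exp (- x\<^sup>2 / 2)) * indicator {b..} x))"
    proof (cases "b \<le> x")
      case True
      then have x: "x \<ge> 0" using assms by simp
      have "ennreal (x * exp (- (x\<^sup>2 + a\<^sup>2) / 2) * bessel_I0 (a * x))
          = ennreal (x * exp (- (x\<^sup>2 + a\<^sup>2) / 2)) * (\<Sum>k. ennreal ((a * x / 2) ^ (2 * k) / (fact k)\<^sup>2))"
        using x by (simp add: ennreal_mult bessel_I0_nonneg flip: ennreal_bessel_I0)
      also have "\<dots> = (\<Sum>k. ennreal (x * exp (- (x\<^sup>2 + a\<^sup>2) / 2)) * ennreal ((a * x / 2) ^ (2 * k) / (fact k)\<^sup>2))"
        by simp
      also have "\<dots> = (\<Sum>k. ennreal (exp (- a\<^sup>2 / 2) * ((a / 2) ^ (2 * k) / (fact k)\<^sup>2)) *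
          ennreal (x ^ (2 * k + 1) * exp (- x\<^sup>2 / 2)))"
      proof (rule suminf_cong)
        fix k
        have "x * exp (- (x\<^sup>2 + a\<^sup>2) / 2) * ((a * x / 2) ^ (2 * k) / (fact k)\<^sup>2)
            = exp (- a\<^sup>2 / 2) * ((a / 2) ^ (2 * k) / (fact k)\<^sup>2) * (x ^ (2 * k + 1) * exp (- x\<^sup>2 / 2))"
        proof -
          have e: "exp (- (x\<^sup>2 + a\<^sup>2) / 2) = exp (- a\<^sup>2 / 2) * exp (- x\<^sup>2 / 2)"
            unfolding mult_exp_exp by (simp add: add_divide_distrib)
          have p: "(a * x / 2) ^ (2 * k) = (a / 2) ^ (2 * k) * x ^ (2 * k)"
            by (simp add: power_mult_distrib power_divide)
          show ?thesis
            unfolding e p by (simp add: algebra_simps)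
        qed
        then show "ennreal (x * exp (- (x\<^sup>2 + a\<^sup>2) / 2)) * ennreal ((a * x / 2) ^ (2 * k) / (fact k)\<^sup>2)
          = ennreal (exp (- a\<^sup>2 / 2) * ((a / 2) ^ (2 * k) / (fact k)\<^sup>2)) * ennreal (x ^ (2 * k + 1) * exp (- x\<^sup>2 / 2))"
          using x by (subst (1 2) ennreal_mult[symmetric]) (simp_all add: zero_le_even_power)
      qed
      finally show ?thesis using True by simp
    qed simp
  qed
  also have "\<dots> = (\<Sum>k. ennreal (exp (- a\<^sup>2 / 2) * ((a / 2) ^ (2 * k) / (fact k)\<^sup>2)) * gaussian_tail k b)"
    unfolding gaussian_tail_def by (subst nn_integral_suminf) (auto simp: nn_integral_cmult)
  finally show ?thesis .
qed

text \<open>Bounding every Gamma tail by the one for k = 0 leaves a common factor exp (- b^2 / 2),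
  and the Poisson weights sum to 1.\<close>

lemma rice_tail_ge:
  assumes "b \<ge> 0"
  shows "ennreal (exp (- b\<^sup>2 / 2)) \<le> rice_tail a b"
proof -
  have "(\<lambda>k. exp (- b\<^sup>2 / 2) * exp (- a\<^sup>2 / 2) * ((a\<^sup>2 / 2) ^ k /\<^sub>R fact k)) sums
      (exp (- b\<^sup>2 / 2) * exp (- a\<^sup>2 / 2) * exp (a\<^sup>2 / 2))"
    by (intro sums_mult exp_converges)
  then have "(\<lambda>k. exp (- b\<^sup>2 / 2) * exp (- a\<^sup>2 / 2) * ((a\<^sup>2 / 2) ^ k /\<^sub>R fact k)) sums exp (- b\<^sup>2 / 2)"
    by (simp add: mult.assoc mult_exp_exp)
  then have "ennreal (exp (- b\<^sup>2 / 2)) = (\<Sum>k. ennreal (exp (- b\<^sup>2 / 2) * exp (- a\<^sup>2 / 2) * ((a\<^sup>2 / 2) ^ k /\<^sub>R fact k)))"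
    by (subst suminf_ennreal2) (auto simp: sums_iff)
  also have "\<dots> \<le> (\<Sum>k. ennreal (exp (- a\<^sup>2 / 2) * ((a / 2) ^ (2 * k) / (fact k)\<^sup>2)) * gaussian_tail k b)"
  proof (rule suminf_le)
    fix k
    have pow: "(a / 2) ^ (2 * k) * 2 ^ k = (a\<^sup>2 / 2) ^ k"
      by (simp add: power_mult power2_eq_square flip: power_mult_distrib)
    have "exp (- b\<^sup>2 / 2) * exp (- a\<^sup>2 / 2) * ((a\<^sup>2 / 2) ^ k /\<^sub>R fact k)
        = exp (- a\<^sup>2 / 2) * ((a / 2) ^ (2 * k) / (fact k)\<^sup>2) * (2 ^ k * fact k * exp (- b\<^sup>2 / 2))"
      unfolding pow[symmetric] by (simp add: field_simps power2_eq_square)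
    then have "ennreal (exp (- b\<^sup>2 / 2) * exp (- a\<^sup>2 / 2) * ((a\<^sup>2 / 2) ^ k /\<^sub>R fact k))
        = ennreal (exp (- a\<^sup>2 / 2) * ((a / 2) ^ (2 * k) / (fact k)\<^sup>2)) * ennreal (2 ^ k * fact k * exp (- b\<^sup>2 / 2))"
      by (simp only:) (rule ennreal_mult, auto simp: zero_le_even_power)
    also have "\<dots> \<le> ennreal (exp (- a\<^sup>2 / 2) * ((a / 2) ^ (2 * k) / (fact k)\<^sup>2)) * gaussian_tail k b"
      by (intro mult_left_mono gaussian_tail_ge assms) simp
    finally show "ennreal (exp (- b\<^sup>2 / 2) * exp (- a\<^sup>2 / 2) * ((a\<^sup>2 / 2) ^ k /\<^sub>R fact k)) \<le> \<dots>" .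
  qed auto
  finally show ?thesis
    by (simp add: rice_tail_series assms)
qed

text \<open>The difference of the two tails is bounded below by replacing \<open>I\<^sub>0\<close> by its lower bound \<open>1\<close>; the terms
  are arranged so that no truncated subtraction in \<^typ>\<open>ennreal\<close> occurs.\<close>

lemma rice_tail_gap:
  assumes "0 \<le> b" "b \<le> b'"
  shows "rice_tail a b' + ennreal (exp (- a\<^sup>2 / 2) * exp (- b\<^sup>2 / 2))
    \<le> rice_tail a b + ennreal (exp (- a\<^sup>2 / 2) * exp (- b'\<^sup>2 / 2))"
proof -
  define f where "f x = ennreal (x * exp (- (x\<^sup>2 + a\<^sup>2) / 2) * bessel_I0 (a * x))" for x
  define g where "g x = ennreal (exp (- a\<^sup>2 / 2)) * ennreal (x * exp (- x\<^sup>2 / 2))" for x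
  have [measurable]: "f \<in> borel_measurable borel" "g \<in> borel_measurable borel"
    unfolding f_def g_def by measurable
  have le: "g x \<le> f x" if "x \<ge> 0" for x
  proof -
    have "g x = ennreal (x * exp (- (x\<^sup>2 + a\<^sup>2) / 2) * 1)"
      using that by (simp add: g_def ennreal_mult[symmetric] mult_exp_exp field_simps)
    also have "\<dots> \<le> f x"
      unfolding f_def using that by (intro ennreal_leI mult_left_mono bessel_I0_ge_1) auto
    finally show ?thesis .
  qed
  have g: "(\<integral>\<^sup>+x. g x * indicator {c..} x \<partial>lborel) = ennreal (exp (- a\<^sup>2 / 2) * exp (- c\<^sup>2 / 2))" if "c \<ge> 0" for c
    using nn_integral_first_moment_tail[OF that] by (simp add: g_def mult.assoc nn_integral_cmult ennreal_mult)
  have "rice_tail a b' + ennreal (exp (- a\<^sup>2 / 2) * exp (- b\<^sup>2 / 2))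
      = (\<integral>\<^sup>+x. f x * indicator {b'..} x + g x * indicator {b..} x \<partial>lborel)"
    using assms by (subst nn_integral_add) (auto simp: rice_tail_def f_def g)
  \<comment> \<open>The integrands differ only on \<open>b \<le> x < b'\<close>, where the left one
    is \<open>g x\<close> and the right one \<open>f x\<close>.\<close>
  also have "\<dots> \<le> (\<integral>\<^sup>+x. f x * indicator {b..} x + g x * indicator {b'..} x \<partial>lborel)"
    using assms le by (intro nn_integral_mono) (auto simp: indicator_def add.commute)
  also have "\<dots> = rice_tail a b + ennreal (exp (- a\<^sup>2 / 2) * exp (- b'\<^sup>2 / 2))"
    using assms by (subst nn_integral_add) (auto simp: rice_tail_def f_def g)
  finally show ?thesis .
qed

lemma marcum_Q1_nonneg:
  assumes "a \<ge> 0" "b \<ge> 0"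
  shows "marcum_Q1 a b \<ge> 0"
  using assms unfolding marcum_Q1_def set_lebesgue_integral_def
  by (intro Bochner_Integration.integral_nonneg) (simp add: bessel_I0_nonneg split: split_indicator)

lemma marcum_Q1_ge:
  assumes "a \<ge> 0" "b \<ge> 0"
  shows "exp (- b\<^sup>2 / 2) \<le> marcum_Q1 a b"
  using rice_tail_ge[of b a] assms marcum_Q1_nonneg[OF assms]
  by (simp add: ennreal_le_iff flip: marcum_Q1_eq_rice_tail)

text \<open>With mean 0 the Rice law is the Rayleigh law; this evaluates the NLoS branch.\<close>

lemma marcum_Q1_0:
  assumes "b \<ge> 0"
  shows "marcum_Q1 0 b = exp (- b\<^sup>2 / 2)"
  using rice_tail_0[of b] assms marcum_Q1_nonneg[of 0 b]
  by (simp flip: marcum_Q1_eq_rice_tail)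

text \<open>The gap is at least exp (- a^2 / 2) times the difference of two Gaussian exponentials,
  which is positive; finiteness permits the subtraction over the reals.\<close>

lemma marcum_Q1_strict_antimono:
  assumes "a \<ge> 0" "0 \<le> b" "b < b'"
  shows "marcum_Q1 a b' < marcum_Q1 a b"
proof -
  have "marcum_Q1 a b' + exp (- a\<^sup>2 / 2) * exp (- b\<^sup>2 / 2) \<le> marcum_Q1 a b + exp (- a\<^sup>2 / 2) * exp (- b'\<^sup>2 / 2)"
    using rice_tail_gap[of b b' a] assms marcum_Q1_nonneg[of a b] marcum_Q1_nonneg[of a b']
    by (simp flip: marcum_Q1_eq_rice_tail ennreal_plus)
  moreover have "b\<^sup>2 < b'\<^sup>2"
    using assms by (intro power_strict_mono) auto
  then have "exp (- a\<^sup>2 / 2) * exp (- b'\<^sup>2 / 2) < exp (- a\<^sup>2 / 2) * exp (- b\<^sup>2 / 2)"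
    by simp
  ultimately show ?thesis by linarith
qed

section \<open>Complex Gaussian measures\<close>

lemma measurable_Complex [measurable (raw)]:
  assumes [measurable]: "f \<in> borel_measurable M" "g \<in> borel_measurable M"
  shows "(\<lambda>x. Complex (f x) (g x)) \<in> borel_measurable M"
  unfolding Complex_eq by measurable

lemma sets_complex_gaussian [measurable_cong, simp]: "sets (complex_gaussian v) = sets borel"
  by (simp add: complex_gaussian_def)

lemma space_complex_gaussian [simp]: "space (complex_gaussian v) = UNIV"
  by (simp add: complex_gaussian_def)

lemma nn_integral_complex_gaussian:
  assumes "v \<ge> 0" and [measurable]: "f \<in> borel_measurable borel"
  shows "(\<integral>\<^sup>+z. f z \<partial>complex_gaussian v)
    = (\<integral>\<^sup>+x. \<integral>\<^sup>+y. f (Complex x y) \<partial>real_gaussian (v / 2) \<partial>real_gaussian (v / 2))"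
proof -
  interpret G: prob_space "real_gaussian (v / 2)"
    using assms by (intro prob_space_real_gaussian) simp
  have "(\<integral>\<^sup>+z. f z \<partial>complex_gaussian v)
      = (\<integral>\<^sup>+p. f (Complex (fst p) (snd p)) \<partial>(real_gaussian (v / 2) \<Otimes>\<^sub>M real_gaussian (v / 2)))"
    unfolding complex_gaussian_def case_prod_beta' by (rule nn_integral_distr) measurable
  also have "\<dots> = (\<integral>\<^sup>+x. \<integral>\<^sup>+y. f (Complex x y) \<partial>real_gaussian (v / 2) \<partial>real_gaussian (v / 2))"
    by (subst G.nn_integral_fst[symmetric]) simp_all
  finally show ?thesis .
qed

lemma prob_space_complex_gaussian:
  assumes "v \<ge> 0"
  shows "prob_space (complex_gaussian v)"
proof
  interpret G: prob_space "real_gaussian (v / 2)"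
    using assms by (intro prob_space_real_gaussian) simp
  show "emeasure (complex_gaussian v) (space (complex_gaussian v)) = 1"
    using nn_integral_complex_gaussian[OF assms, of "\<lambda>_. 1"] G.emeasure_space_1 by simp
qed

text \<open>Exchanging the two middle integrals puts imaginary parts next to imaginary parts and
  real parts next to real parts; the one-dimensional law is then applied twice.\<close>

lemma nn_integral_complex_gaussian_add:
  assumes "v \<ge> 0" "w \<ge> 0" and [measurable]: "f \<in> borel_measurable borel"
  shows "(\<integral>\<^sup>+z. \<integral>\<^sup>+z'. f (z + z') \<partial>complex_gaussian w \<partial>complex_gaussian v) = (\<integral>\<^sup>+z. f z \<partial>complex_gaussian (v + w))"
proof -
  interpret v: prob_space "real_gaussian (v / 2)"
    using assms by (intro prob_space_real_gaussian) simp
  interpret w: prob_space "real_gaussian (w / 2)"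
    using assms by (intro prob_space_real_gaussian) simp
  interpret vw: prob_space "real_gaussian (v / 2 + w / 2)"
    using assms by (intro prob_space_real_gaussian) simp
  interpret W: prob_space "complex_gaussian w"
    using assms by (intro prob_space_complex_gaussian)
  interpret P: pair_sigma_finite "real_gaussian (w / 2)" "real_gaussian (v / 2)" ..
  have "(\<integral>\<^sup>+z. \<integral>\<^sup>+z'. f (z + z') \<partial>complex_gaussian w \<partial>complex_gaussian v)
      = (\<integral>\<^sup>+x. \<integral>\<^sup>+y. \<integral>\<^sup>+x'. \<integral>\<^sup>+y'. f (Complex (x + x') (y + y'))
          \<partial>real_gaussian (w / 2) \<partial>real_gaussian (w / 2) \<partial>real_gaussian (v / 2) \<partial>real_gaussian (v / 2))"
    using assms by (subst nn_integral_complex_gaussian) (simp_all add: nn_integral_complex_gaussian complex_add)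
  also have "\<dots> = (\<integral>\<^sup>+x. \<integral>\<^sup>+x'. \<integral>\<^sup>+y. \<integral>\<^sup>+y'. f (Complex (x + x') (y + y'))
          \<partial>real_gaussian (w / 2) \<partial>real_gaussian (v / 2) \<partial>real_gaussian (w / 2) \<partial>real_gaussian (v / 2))"
    by (rule nn_integral_cong, rule P.Fubini') measurable
  also have "\<dots> = (\<integral>\<^sup>+x. \<integral>\<^sup>+x'. \<integral>\<^sup>+y. f (Complex (x + x') y)
          \<partial>real_gaussian (v / 2 + w / 2) \<partial>real_gaussian (w / 2) \<partial>real_gaussian (v / 2))"
    using assms by (intro nn_integral_cong nn_integral_real_gaussian_add) auto
  also have "\<dots> = (\<integral>\<^sup>+x. \<integral>\<^sup>+y. f (Complex x y) \<partial>real_gaussian (v / 2 + w / 2) \<partial>real_gaussian (v / 2 + w / 2))"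
    using assms by (intro nn_integral_real_gaussian_add) auto
  also have "\<dots> = (\<integral>\<^sup>+z. f z \<partial>complex_gaussian (v + w))"
    using assms by (simp add: nn_integral_complex_gaussian add_divide_distrib)
  finally show ?thesis .
qed

lemma complex_gaussian_0: "complex_gaussian 0 = return borel 0"
proof (rule measure_eqI)
  fix A assume "A \<in> sets (complex_gaussian 0)"
  then have [measurable]: "A \<in> sets borel" by simp
  have "emeasure (complex_gaussian 0) A = (\<integral>\<^sup>+z. indicator A z \<partial>complex_gaussian 0)"
    by simp
  also have "\<dots> = indicator A (Complex 0 0)"
    by (subst nn_integral_complex_gaussian) (simp_all add: real_gaussian_def nn_integral_return)
  finally show "emeasure (complex_gaussian 0) A = emeasure (return borel 0) A"
    by (simp add: zero_complex.code)
qed simp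

lemma (in prob_space) distr_sum_complex_gaussian:
  fixes X :: "'i \<Rightarrow> 'a \<Rightarrow> complex"
  assumes "finite I" "indep_vars (\<lambda>_. borel) X I"
    and "\<And>i. i \<in> I \<Longrightarrow> v i \<ge> 0" "\<And>i. i \<in> I \<Longrightarrow> distr M borel (X i) = complex_gaussian (v i)"
  shows "distr M borel (\<lambda>\<omega>. \<Sum>i\<in>I. X i \<omega>) = complex_gaussian (\<Sum>i\<in>I. v i)"
  using assms
proof (induction I rule: finite_induct)
  case empty
  then show ?case
    using distr_const[of 0 borel] by (simp add: complex_gaussian_0)
next
  case (insert i I)
  let ?Y = "\<lambda>\<omega>. \<Sum>j\<in>I. X j \<omega>"
  have IH: "distr M borel ?Y = complex_gaussian (sum v I)"
    using insert.prems by (intro insert.IH indep_vars_subset[OF insert.prems(1)]) auto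
  \<comment> \<open>Grouping the family into the blocks \<open>{i}\<close> and \<open>I\<close>
    makes the new summand independent of the sum of the others.\<close>
  have "indep_var
    borel ((\<lambda>f. f i) \<circ> (\<lambda>\<omega>. restrict (\<lambda>i. X i \<omega>) {i}))
    borel ((\<lambda>f. \<Sum>i\<in>I. f i) \<circ> (\<lambda>\<omega>. restrict (\<lambda>i. X i \<omega>) I))"
    using insert by (intro indep_var_compose[OF indep_var_restrict[OF insert.prems(1)]]) auto
  also have "((\<lambda>f. f i) \<circ> (\<lambda>\<omega>. restrict (\<lambda>i. X i \<omega>) {i})) = X i"
    by auto
  also have "((\<lambda>f. \<Sum>i\<in>I. f i) \<circ> (\<lambda>\<omega>. restrict (\<lambda>i. X i \<omega>) I)) = ?Y"
    by (auto cong: rev_conj_cong)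
  finally have indep: "indep_var borel (X i) borel ?Y" .
  then have [measurable]: "X i \<in> borel_measurable M" "?Y \<in> borel_measurable M"
    by (auto dest: indep_var_rv1 indep_var_rv2)
  interpret Y: prob_space "distr M borel ?Y"
    by (rule prob_space_distr) measurable
  have "distr M borel (\<lambda>\<omega>. X i \<omega> + ?Y \<omega>) = complex_gaussian (v i + sum v I)"
  proof (rule measure_eqI)
    fix A assume "A \<in> sets (distr M borel (\<lambda>\<omega>. X i \<omega> + ?Y \<omega>))"
    then have [measurable]: "A \<in> sets borel" by simp
    have "emeasure (distr M borel (\<lambda>\<omega>. X i \<omega> + ?Y \<omega>)) A = (\<integral>\<^sup>+\<omega>. indicator A (X i \<omega> + ?Y \<omega>) \<partial>M)"
      by (subst nn_integral_distr[symmetric, of "\<lambda>\<omega>. X i \<omega> + ?Y \<omega>" M borel]) simp_all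
    also have "\<dots> = (\<integral>\<^sup>+p. indicator A (fst p + snd p) \<partial>(distr M borel (X i) \<Otimes>\<^sub>M distr M borel ?Y))"
      using indep unfolding indep_var_distribution_eq by (simp add: nn_integral_distr)
    also have "\<dots> = (\<integral>\<^sup>+z. \<integral>\<^sup>+z'. indicator A (z + z') \<partial>distr M borel ?Y \<partial>distr M borel (X i))"
      by (subst Y.nn_integral_fst[symmetric]) simp_all
    also have "\<dots> = (\<integral>\<^sup>+z. indicator A z \<partial>complex_gaussian (v i + sum v I))"
      using insert.prems by (simp add: IH nn_integral_complex_gaussian_add sum_nonneg)
    finally show "emeasure (distr M borel (\<lambda>\<omega>. X i \<omega> + ?Y \<omega>)) A = emeasure (complex_gaussian (v i + sum v I)) A"
      by simp
  qed simp
  then show ?case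
    using insert.hyps by simp
qed

lemma measure_complex_gaussian_cmod_ge:
  assumes "v > 0" "s \<ge> 0"
  shows "measure (complex_gaussian v) {z. s \<le> cmod (c + z)}
    = marcum_Q1 (sqrt 2 * cmod c / sqrt v) (sqrt 2 * s / sqrt v)"
proof -
  \<comment> \<open>The standard deviation of each coordinate; scaling by it is where the factor
    \<open>sqrt 2\<close> of \<open>a_arg\<close> and \<open>b_arg\<close> comes from.\<close>
  define \<sigma> where "\<sigma> = sqrt (v / 2)"
  have \<sigma>: "\<sigma> > 0" "v / 2 = \<sigma>\<^sup>2"
    using assms by (auto simp: \<sigma>_def)
  interpret N: prob_space std_normal_distribution
    by (rule prob_space_std_normal)
  interpret G: prob_space "real_gaussian (v / 2)"
    using assms by (intro prob_space_real_gaussian) simp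
  define \<alpha> \<beta> where "\<alpha> = Re c / \<sigma>" and "\<beta> = Im c / \<sigma>"
  have iff: "s \<le> cmod (c + Complex (\<sigma> * x) (\<sigma> * y)) \<longleftrightarrow> (s / \<sigma>)\<^sup>2 \<le> (\<alpha> + x)\<^sup>2 + (\<beta> + y)\<^sup>2" for x y
  proof -
    have "s \<le> cmod (c + Complex (\<sigma> * x) (\<sigma> * y)) \<longleftrightarrow> s\<^sup>2 \<le> (Re c + \<sigma> * x)\<^sup>2 + (Im c + \<sigma> * y)\<^sup>2"
      using assms real_sqrt_le_iff[of "s\<^sup>2" "(Re c + \<sigma> * x)\<^sup>2 + (Im c + \<sigma> * y)\<^sup>2"]
      by (simp add: cmod_def)
    also have "(Re c + \<sigma> * x)\<^sup>2 + (Im c + \<sigma> * y)\<^sup>2 = \<sigma>\<^sup>2 * ((\<alpha> + x)\<^sup>2 + (\<beta> + y)\<^sup>2)"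
      using \<sigma>(1) by (simp add: \<alpha>_def \<beta>_def distrib_left flip: power_mult_distrib)
    also have "s\<^sup>2 \<le> \<dots> \<longleftrightarrow> (s / \<sigma>)\<^sup>2 \<le> (\<alpha> + x)\<^sup>2 + (\<beta> + y)\<^sup>2"
      using \<sigma>(1) by (simp add: power_divide pos_divide_le_eq mult.commute)
    finally show ?thesis .
  qed
  have "{z. s \<le> cmod (c + z)} \<in> sets borel"
    by (intro borel_closed closed_Collect_le continuous_intros)
  then have "emeasure (complex_gaussian v) {z. s \<le> cmod (c + z)}
      = (\<integral>\<^sup>+z. indicator {z. s \<le> cmod (c + z)} z \<partial>complex_gaussian v)"
    by simp
  also have "\<dots> = (\<integral>\<^sup>+z. indicator {s..} (cmod (c + z)) \<partial>complex_gaussian v)"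
    by (intro nn_integral_cong) (simp add: indicator_def)
  also have "\<dots> = (\<integral>\<^sup>+x. \<integral>\<^sup>+y. indicator {s..} (cmod (c + Complex x y)) \<partial>real_gaussian (v / 2) \<partial>real_gaussian (v / 2))"
    using assms by (intro nn_integral_complex_gaussian) auto
  also have "\<dots> = (\<integral>\<^sup>+x. \<integral>\<^sup>+y. indicator {s..} (cmod (c + Complex (\<sigma> * x) (\<sigma> * y))) \<partial>std_normal_distribution \<partial>std_normal_distribution)"
    unfolding \<sigma>(2) distr_scale_std_normal[symmetric] by (simp add: nn_integral_distr)
  also have "\<dots> = (\<integral>\<^sup>+x. \<integral>\<^sup>+y. indicator {(s / \<sigma>)\<^sup>2..} ((\<alpha> + x)\<^sup>2 + (\<beta> + y)\<^sup>2) \<partial>std_normal_distribution \<partial>std_normal_distribution)"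
    by (intro nn_integral_cong) (simp add: indicator_def iff)
  also have "\<dots> = rice_tail (sqrt (\<alpha>\<^sup>2 + \<beta>\<^sup>2)) (s / \<sigma>)"
    using assms \<sigma>(1) by (intro nn_integral_rice) simp
  also have "sqrt (\<alpha>\<^sup>2 + \<beta>\<^sup>2) = cmod c / \<sigma>"
    using \<sigma>(1) by (simp add: \<alpha>_def \<beta>_def power_divide cmod_def real_sqrt_divide flip: add_divide_distrib)
  also have "rice_tail (cmod c / \<sigma>) (s / \<sigma>) = ennreal (marcum_Q1 (cmod c / \<sigma>) (s / \<sigma>))"
    using assms \<sigma>(1) by (intro marcum_Q1_eq_rice_tail[symmetric]) auto
  finally have "measure (complex_gaussian v) {z. s \<le> cmod (c + z)} = marcum_Q1 (cmod c / \<sigma>) (s / \<sigma>)"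
    using assms \<sigma>(1) by (simp add: measure_def marcum_Q1_nonneg)
  then show ?thesis
    by (simp add: \<sigma>_def real_sqrt_divide mult.commute)
qed

section \<open>The channel\<close>

context los_nlos_channel
begin

sublocale prob_space "pspace S"
  by (rule prob_space)

lemma user_dist_pos: "user_dist S \<xi> > 0"
  using height_pos by (simp add: user_dist_def add_nonneg_pos)

lemma los_prob_bounds: "0 \<le> los_prob S \<xi>" "los_prob S \<xi> \<le> 1"
  using beta_range by (auto simp: los_prob_def)

lemma mu_total_power2: "(mu_total S)\<^sup>2 = (\<Sum>n = 1..Nc S. (mu S n)\<^sup>2)"
  by (simp add: mu_total_def sum_nonneg)

text \<open>Identifies the NLoS exponent with b^2 / 2, so that both tails are compared at the same
  \<open>b\<close>.\<close>

lemma b_arg_power2: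
  assumes "t \<ge> 0"
  shows "(b_arg S r t)\<^sup>2 / 2 = t * r\<^sup>2 / (rho S * (mu_total S)\<^sup>2)"
  using assms rho_pos by (simp add: b_arg_def power_mult_distrib power_divide mult_ac)

lemma measurable_h_nlos:
  assumes "\<xi> \<in> {0..Dx S}"
  shows "h_nlos S \<xi> \<in> borel_measurable (pspace S)"
  using los_nlos_indep[OF assms] by (rule indep_var_rv2)

lemma distr_h_nlos:
  assumes "\<xi> \<in> {0..Dx S}"
  shows "distr (pspace S) borel (h_nlos S \<xi>) = complex_gaussian ((mu_total S)\<^sup>2 / (user_dist S \<xi>)\<^sup>2)"
  using distr_sum_complex_gaussian[OF _ scatter_indep[OF assms] _ scatter_law[OF assms]]
  by (simp add: h_nlos_def[abs_def] mu_total_power2 sum_divide_distrib)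

lemma cmod_h_los: "cmod (h_los S \<xi>) = sqrt (eta S) / user_dist S \<xi>"
  using eta_pos user_dist_pos[of \<xi>] by (simp add: h_los_def norm_mult norm_divide norm_exp_eq_Re)

lemma prob_los_flag:
  assumes "\<xi> \<in> {0..Dx S}"
  shows "\<P>(\<omega> in pspace S. los_flag S \<xi> \<omega> = c) = (if c then los_prob S \<xi> else 1 - los_prob S \<xi>)"
proof -
  have "\<P>(\<omega> in pspace S. los_flag S \<xi> \<omega> = c)
      = measure (distr (pspace S) (count_space UNIV) (los_flag S \<xi>)) {c}"
    using los_flag_measurable[OF assms]
    by (subst measure_distr) (auto intro!: arg_cong[where f = prob])
  then show ?thesis
    using los_prob_bounds[of \<xi>] by (auto simp: los_flag_law[OF assms] measure_pmf_single)
qed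

text \<open>The constant \<open>z\<close> is left free so that both branches are instances:
  \<open>h_los S \<xi>\<close> when the flag holds, 0 otherwise.\<close>

lemma prob_los_flag_nlos:
  assumes "\<xi> \<in> {0..Dx S}" "s \<ge> 0"
  shows "\<P>(\<omega> in pspace S. los_flag S \<xi> \<omega> = c \<and> s \<le> cmod (z + h_nlos S \<xi> \<omega>))
    = (if c then los_prob S \<xi> else 1 - los_prob S \<xi>) *
      marcum_Q1 (sqrt 2 * cmod z * user_dist S \<xi> / mu_total S) (sqrt 2 * s * user_dist S \<xi> / mu_total S)"
proof -
  let ?A = "{w. s \<le> cmod (z + w)}"
  have A: "?A \<in> sets borel"
    by (intro borel_closed closed_Collect_le continuous_intros)
  have "\<P>(\<omega> in pspace S. los_flag S \<xi> \<omega> = c \<and> s \<le> cmod (z + h_nlos S \<xi> \<omega>))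
      = \<P>(\<omega> in pspace S. of_bool (los_flag S \<xi> \<omega>) \<in> {of_bool c :: complex} \<and> h_nlos S \<xi> \<omega> \<in> ?A)"
    by simp
  also have "\<dots> = \<P>(\<omega> in pspace S. of_bool (los_flag S \<xi> \<omega>) \<in> {of_bool c :: complex}) * \<P>(\<omega> in pspace S. h_nlos S \<xi> \<omega> \<in> ?A)"
    using A by (intro prob_indep_random_variable[OF los_nlos_indep[OF assms(1)]]) auto
  also have "\<P>(\<omega> in pspace S. of_bool (los_flag S \<xi> \<omega>) \<in> {of_bool c :: complex}) = \<P>(\<omega> in pspace S. los_flag S \<xi> \<omega> = c)"
    by simp
  also have "\<P>(\<omega> in pspace S. h_nlos S \<xi> \<omega> \<in> ?A) = measure (distr (pspace S) borel (h_nlos S \<xi>)) ?A"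
    using measurable_h_nlos[OF assms(1)] A
    by (subst measure_distr) (auto intro!: arg_cong[where f = prob])
  also have "\<dots> = marcum_Q1 (sqrt 2 * cmod z * user_dist S \<xi> / mu_total S) (sqrt 2 * s * user_dist S \<xi> / mu_total S)"
    using measure_complex_gaussian_cmod_ge[of "(mu_total S)\<^sup>2 / (user_dist S \<xi>)\<^sup>2" s z] assms
      mu_total_pos user_dist_pos[of \<xi>]
    by (simp add: distr_h_nlos real_sqrt_divide)
  finally show ?thesis
    by (simp add: prob_los_flag[OF assms(1)])
qed

lemma snr_ccdf_eq:
  assumes "\<xi> \<in> {0..Dx S}" "t \<ge> 0"
  shows "snr_ccdf S \<xi> t =
    los_prob S \<xi> * marcum_Q1 (a_arg S) (b_arg S (user_dist S \<xi>) t)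
    + (1 - los_prob S \<xi>) * exp (- (t * (user_dist S \<xi>)\<^sup>2 / (rho S * (mu_total S)\<^sup>2)))"
proof -
  define s where "s = sqrt (t / rho S)"
  let ?E = "\<lambda>c. {\<omega> \<in> space (pspace S). los_flag S \<xi> \<omega> = c \<and> s \<le> cmod ((if c then h_los S \<xi> else 0) + h_nlos S \<xi> \<omega>)}"
  note [measurable] = los_flag_measurable[OF assms(1)] measurable_h_nlos[OF assms(1)]
  have s: "s \<ge> 0"
    using assms rho_pos by (simp add: s_def)
  have "snr S \<xi> \<omega> \<ge> t \<longleftrightarrow> s \<le> cmod (h_chan S \<xi> \<omega>)" for \<omega>
    using assms rho_pos real_sqrt_le_iff[of "t / rho S" "(cmod (h_chan S \<xi> \<omega>))\<^sup>2"]
    by (simp add: snr_def s_def pos_divide_le_eq mult.commute)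
  then have "snr_ccdf S \<xi> t = prob (?E True \<union> ?E False)"
    unfolding snr_ccdf_def by (intro arg_cong[where f = prob]) (auto simp: h_chan_def)
  also have "\<dots> = prob (?E True) + prob (?E False)"
    by (intro finite_measure_Union) auto
  \<comment> \<open>The modulus of the LoS part is inversely proportional to the distance, so the
    distance cancels in the first Marcum argument; only \<open>b_arg\<close> retains it.\<close>
  also have "prob (?E True) = los_prob S \<xi> * marcum_Q1 (a_arg S) (b_arg S (user_dist S \<xi>) t)"
    using prob_los_flag_nlos[OF assms(1) s, of True "h_los S \<xi>"] user_dist_pos[of \<xi>]
    by (simp add: cmod_h_los a_arg_def b_arg_def s_def mult_ac)
  also have "prob (?E False) = (1 - los_prob S \<xi>) * marcum_Q1 0 (b_arg S (user_dist S \<xi>) t)"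
    using prob_los_flag_nlos[OF assms(1) s, of False 0] user_dist_pos[of \<xi>]
    by (simp add: b_arg_def s_def mult_ac)
  also have "marcum_Q1 0 (b_arg S (user_dist S \<xi>) t) = exp (- (b_arg S (user_dist S \<xi>) t)\<^sup>2 / 2)"
    using assms rho_pos mu_total_pos user_dist_pos[of \<xi>] by (intro marcum_Q1_0) (simp add: b_arg_def)
  finally show ?thesis
    using b_arg_power2[OF assms(2)] by simp
qed

end

text \<open>Raise both tails at the fixed weight \<open>p'\<close>, then move the weight
  \<open>p - p'\<close> from the smaller tail \<open>e\<close> to the larger tail
  \<open>q\<close>.\<close>

lemma convex_combination_strict_antimono:
  fixes p p' q q' e e' :: real
  assumes "0 \<le> p'" "p' \<le> p" "p' \<le> 1" "e \<le> q" "q' < q" "e' < e"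
  shows "p' * q' + (1 - p') * e' < p * q + (1 - p) * e"
proof -
  have "p' * q' + (1 - p') * e' < p' * q + (1 - p') * e"
  \<comment> \<open>If \<open>p' = 0\<close>, strictness comes from \<open>e' < e\<close>. Otherwise
    it comes from \<open>q' < q\<close>, since \<open>1 - p'\<close> may vanish, as it does for
    \<beta> = 0.\<close>
  proof (cases "p' = 0")
    case False
    then show ?thesis
      using assms by (intro add_less_le_mono mult_strict_left_mono mult_left_mono) auto
  qed (use assms in simp)
  also have "\<dots> \<le> p' * q + (1 - p') * e + (p - p') * (q - e)"
    using assms by simp
  also have "\<dots> = p * q + (1 - p) * e"
    by (simp add: algebra_simps)
  finally show ?thesis .
qed

text \<open>The antenna positions of one channel realise only some distances. Monotonicity is
  therefore stated between two channels that share \<beta>, \<eta>, the total NLoS power and \<rho>,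
  while geometry, wavelengths, scatterers and probability space may differ; \<open>S' = S\<close> is
  the case of a moving antenna.\<close>

theorem proposition2:
  fixes S :: "'a channel"
  assumes "los_nlos_channel S"
  shows "(\<forall>\<xi>\<in>{0..Dx S}. \<forall>t\<ge>0.
            snr_ccdf S \<xi> t =
              exp (- beta S * (user_dist S \<xi>)\<^sup>2) * marcum_Q1 (a_arg S) (b_arg S (user_dist S \<xi>) t)
              + (1 - exp (- beta S * (user_dist S \<xi>)\<^sup>2))
                * exp (- (t * (user_dist S \<xi>)\<^sup>2 / (rho S * (mu_total S)\<^sup>2))))
       \<and> (\<forall>(S' :: 'b channel) \<xi> \<xi>' t.
            los_nlos_channel S' \<longrightarrow>
            beta S' = beta S \<longrightarrow> eta S' = eta S \<longrightarrow> mu_total S' = mu_total S \<longrightarrow> rho S' = rho S \<longrightarrow>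
            \<xi> \<in> {0..Dx S} \<longrightarrow> \<xi>' \<in> {0..Dx S'} \<longrightarrow> t > 0 \<longrightarrow>
            user_dist S \<xi> < user_dist S' \<xi>' \<longrightarrow>
            snr_ccdf S' \<xi>' t < snr_ccdf S \<xi> t)"
proof (intro conjI ballI allI impI)
  fix \<xi> t assume "\<xi> \<in> {0..Dx S}" "0 \<le> (t::real)"
  then show "snr_ccdf S \<xi> t =
      exp (- beta S * (user_dist S \<xi>)\<^sup>2) * marcum_Q1 (a_arg S) (b_arg S (user_dist S \<xi>) t)
      + (1 - exp (- beta S * (user_dist S \<xi>)\<^sup>2))
        * exp (- (t * (user_dist S \<xi>)\<^sup>2 / (rho S * (mu_total S)\<^sup>2)))"
    using los_nlos_channel.snr_ccdf_eq[OF assms] by (simp only: los_prob_def)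
next
  fix S' :: "'b channel" and \<xi> \<xi>' t :: real
  assume S': "los_nlos_channel S'"
    and same: "beta S' = beta S" "eta S' = eta S" "mu_total S' = mu_total S" "rho S' = rho S"
    and \<xi>: "\<xi> \<in> {0..Dx S}" "\<xi>' \<in> {0..Dx S'}" and t: "t > 0"
    and less: "user_dist S \<xi> < user_dist S' \<xi>'"
  interpret S: los_nlos_channel S by fact
  interpret S': los_nlos_channel S' by fact
  define r r' where "r = user_dist S \<xi>" and "r' = user_dist S' \<xi>'"
  note pos = S.eta_pos S.rho_pos S.mu_total_pos
  have r: "0 < r" "r < r'" "r\<^sup>2 < r'\<^sup>2"
    using less S.user_dist_pos[of \<xi>] by (auto simp: r_def r'_def intro!: power_strict_mono)
  have "los_prob S' \<xi>' * marcum_Q1 (a_arg S) (b_arg S r' t)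
        + (1 - los_prob S' \<xi>') * exp (- (t * r'\<^sup>2 / (rho S * (mu_total S)\<^sup>2)))
      < los_prob S \<xi> * marcum_Q1 (a_arg S) (b_arg S r t)
        + (1 - los_prob S \<xi>) * exp (- (t * r\<^sup>2 / (rho S * (mu_total S)\<^sup>2)))"
  proof (rule convex_combination_strict_antimono)
    have a: "a_arg S \<ge> 0" and b: "b_arg S r t \<ge> 0"
      using pos r t by (auto simp: a_arg_def b_arg_def)
    show "los_prob S' \<xi>' \<le> los_prob S \<xi>"
      using S.beta_range r by (simp add: los_prob_def same r_def r'_def mult_left_mono)
    show "exp (- (t * r\<^sup>2 / (rho S * (mu_total S)\<^sup>2))) \<le> marcum_Q1 (a_arg S) (b_arg S r t)"
      using marcum_Q1_ge[OF a b] S.b_arg_power2[of t r] t by simp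
    have "b_arg S r t < b_arg S r' t"
      using pos r t by (simp add: b_arg_def divide_strict_right_mono)
    then show "marcum_Q1 (a_arg S) (b_arg S r' t) < marcum_Q1 (a_arg S) (b_arg S r t)"
      by (rule marcum_Q1_strict_antimono[OF a b])
    show "exp (- (t * r'\<^sup>2 / (rho S * (mu_total S)\<^sup>2))) < exp (- (t * r\<^sup>2 / (rho S * (mu_total S)\<^sup>2)))"
      using pos r t by (simp add: divide_strict_right_mono)
  qed (use S'.los_prob_bounds in auto)
  then show "snr_ccdf S' \<xi>' t < snr_ccdf S \<xi> t"
    using S.snr_ccdf_eq[OF \<xi>(1), of t] S'.snr_ccdf_eq[OF \<xi>(2), of t] t
    by (simp add: same a_arg_def b_arg_def r_def r'_def)
qed

end
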